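(* Let $x=\frac{r\pm\sqrt{p}}{s}$ be a real quadratic irrational number ($r\in\mathbb{Z}$, $s,p\in\mathbb{Z}_{>0}$, $p$ not a perfect square). Then its $q$-deformation $[x]_q$ satisfies: (i) $[x]_{q}=\frac{\mathcal{R}\pm\sqrt{\mathcal{P}}}{\mathcal{S}}$ for some $\mathcal{R},\mathcal{P},\mathcal{S}\in\mathbb{Z}[q]$ with $\mathcal{P}$ a palindrome; (ii) $[x]_{q}$ is a solution of an equation $\mathcal{A}X^{2}+\mathcal{B}X+\mathcal{C}=0$ with $\mathcal{A},\mathcal{B},\mathcal{C}\in\mathbb{Z}[q]$; (iii) there exists a matrix $M_{q}=\begin{pmatrix}A&B\\ C&D\end{pmatrix}\in\mathrm{GL}(2,\mathbb{Z}[q^{\pm1}])$ such that $M_{q}\cdot[x]_{q}=[x]_{q}$, where $M_q\cdot f:=\frac{Af+B}{Cf+D}$; (iv) $[x]_{q}$ has a periodic continued fraction expansion, i.e. $[x]_q=[a_1,a_2,a_3,\ldots]_q$ for some eventually periodic sequence of integers $(a_i)_{i\ge1}$ with $a_i\ge1$ for $i\ge2$.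
   Context: $q$ is a formal variable; $[n]_q:=\frac{1-q^n}{1-q}$ for $n\in\mathbb{Z}$. For integers $a_1,\dots,a_{2m}$, define the finite $q$-continued fraction $$[a_1,\ldots,a_{2m}]_q:=[a_1]_{q} + \cfrac{q^{a_{1}}}{[a_2]_{q^{-1}} + \cfrac{q^{-a_{2}}}{[a_{3}]_{q} +\cfrac{q^{a_{3}}}{\ddots+\cfrac{q^{-a_{2m-2}}}{[a_{2m-1}]_q+\cfrac{q^{a_{2m-1}}}{[a_{2m}]_{q^{-1}}}}}}}.$$ Every rational $\frac rs$ has a unique expansion $\frac rs=a_1+\cfrac{1}{a_2+\cfrac{1}{\ddots+\cfrac{1}{a_{2m}}}}$ of even length with $a_1\in\mathbb{Z}$, $a_i\ge1$ for $i\ge2$, and $[\frac rs]_q:=[a_1,\ldots,a_{2m}]_q$, viewed as a Laurent series in $q$. For irrational $x$ and any rationals $x_n\to x$, the coefficients of the Laurent series $[x_n]_q$ stabilize to integers independent of the sequence, with finitely many nonzero negative-index coefficients; the resulting Laurent series is $[x]_q$. For an integer sequence $(a_i)_{i\ge1}$ with $a_i\ge1$ for $i\ge2$, $[a_1,a_2,\ldots]_q$ denotes the limit of $[a_1,\ldots,a_{2m}]_q$ as $m\to\infty$ (which equals $[x]_q$ for $x=a_1+\cfrac{1}{a_2+\cfrac{1}{\ddots}}$). A Laurent polynomial $\mathcal{P}\in\mathbb{Z}[q,q^{-1}]$ is a palindrome if $\mathcal{P}(q)=q^N\mathcal{P}(q^{-1})$ for some $N\in\mathbb{Z}$. *)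

theory Defs
  imports
    "HOL-Analysis.Cartesian_Space"
    "HOL-Computational_Algebra.Formal_Laurent_Series"
    "HOL-Library.Poly_Mapping"
begin

text \<open>
  All \<open>q\<close>-deformations live in the field \<open>\<rat>((q))\<close>, i.e. \<^typ>\<open>rat fls\<close>, with \<open>q\<close> being
  \<^const>\<open>fls_X\<close>. The ring \<open>\<int>[q]\<close> is \<^typ>\<open>int poly\<close>. The ring \<open>\<int>[q\<^sup>\<plusminus>\<^sup>1]\<close> is the group ring of
  \<open>\<int>\<close> over \<open>\<int>\<close>: an element \<open>f\<close> of the type below stands for the sum of all \<open>f(n) q\<^sup>n\<close>, and the
  product is convolution.
\<close>

type_synonym int_laurent = "int \<Rightarrow>\<^sub>0 int"

definition laurent_of_poly :: "int poly \<Rightarrow> int_laurent" where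
  "laurent_of_poly P = (\<Sum>i\<le>degree P. Poly_Mapping.single (int i) (coeff P i))"

definition fls_of_laurent :: "int_laurent \<Rightarrow> rat fls" where
  "fls_of_laurent f = (\<Sum>n\<in>Poly_Mapping.keys f. of_int (Poly_Mapping.lookup f n) * fls_X powi n)"

definition fls_of_poly :: "int poly \<Rightarrow> rat fls" where
  "fls_of_poly P = fls_of_laurent (laurent_of_poly P)"

text \<open>\<open>P(q) = q\<^sup>N P(q\<^sup>-\<^sup>1)\<close>: precomposing the exponents with negation substitutes \<open>q\<^sup>-\<^sup>1\<close> for \<open>q\<close>.\<close>

definition palindrome :: "int_laurent \<Rightarrow> bool" where
  "palindrome P \<longleftrightarrow>
     (\<exists>N::int. P = Poly_Mapping.single N 1 * Poly_Mapping.map_key uminus P)"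

definition q_int :: "'a::field \<Rightarrow> int \<Rightarrow> 'a" where
  "q_int q n = (1 - q powi n) / (1 - q)"

text \<open>
  The base alternates between \<open>q\<close> and \<open>q\<^sup>-\<^sup>1\<close> from one level to the next; the level with base
  \<open>q\<^sup>-\<^sup>1\<close> has numerator \<open>(q\<^sup>-\<^sup>1)\<^sup>a = q\<^sup>-\<^sup>a\<close>. The value at the empty list is never used.
\<close>

fun q_cfrac :: "'a::field \<Rightarrow> int list \<Rightarrow> 'a" where
  "q_cfrac q [] = 0"
| "q_cfrac q [a] = q_int q a"
| "q_cfrac q (a # b # as) = q_int q a + q powi a / q_cfrac (inverse q) (b # as)"

fun cfrac :: "int list \<Rightarrow> rat" where
  "cfrac [] = 0"
| "cfrac [a] = of_int a"
| "cfrac (a # b # as) = of_int a + 1 / cfrac (b # as)"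

definition even_expansion :: "rat \<Rightarrow> int list \<Rightarrow> bool" where
  "even_expansion y as \<longleftrightarrow>
     as \<noteq> [] \<and> even (length as) \<and> (\<forall>a\<in>set (tl as). a \<ge> 1) \<and> cfrac as = y"

definition q_rat :: "rat \<Rightarrow> rat fls" where
  "q_rat y = q_cfrac fls_X (THE as. even_expansion y as)"

text \<open>Convergence of Laurent series here is stabilization of every single coefficient.\<close>

definition stabilizes_to :: "(nat \<Rightarrow> rat fls) \<Rightarrow> rat fls \<Rightarrow> bool" where
  "stabilizes_to F f \<longleftrightarrow>
     (\<forall>k. eventually (\<lambda>n. fls_nth (F n) k = fls_nth f k) sequentially)"

text \<open>\<open>[x]\<^sub>q\<close> for irrational \<open>x\<close>; the definition is meaningful for irrational arguments only.\<close>

definition q_irrat :: "real \<Rightarrow> rat fls" where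
  "q_irrat x = (THE f. \<forall>xs :: nat \<Rightarrow> rat.
     (\<lambda>n. of_rat (xs n)) \<longlonglongrightarrow> x \<longrightarrow> stabilizes_to (\<lambda>n. q_rat (xs n)) f)"

text \<open>The sequence is \<open>a\<^sub>1, a\<^sub>2, \<dots>\<close>; the value \<open>a 0\<close> is ignored.\<close>

definition is_q_cfrac_limit :: "(nat \<Rightarrow> int) \<Rightarrow> rat fls \<Rightarrow> bool" where
  "is_q_cfrac_limit a f \<longleftrightarrow> stabilizes_to (\<lambda>m. q_cfrac fls_X (map a [1..<2 * m + 1])) f"

definition eventually_periodic :: "(nat \<Rightarrow> 'a) \<Rightarrow> bool" where
  "eventually_periodic a \<longleftrightarrow> (\<exists>k>0. \<exists>i0. \<forall>i\<ge>i0. a (i + k) = a i)"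

definition mobius_num :: "int_laurent ^ 2 ^ 2 \<Rightarrow> rat fls \<Rightarrow> rat fls" where
  "mobius_num M f = fls_of_laurent (M $ 1 $ 1) * f + fls_of_laurent (M $ 1 $ 2)"

definition mobius_den :: "int_laurent ^ 2 ^ 2 \<Rightarrow> rat fls \<Rightarrow> rat fls" where
  "mobius_den M f = fls_of_laurent (M $ 2 $ 1) * f + fls_of_laurent (M $ 2 $ 2)"

end

theory Submission
  imports Defs
begin

text \<open>
  On positive irrationals consider the slow continued fraction map \<open>T\<close>, \<open>x \<mapsto> x - 1\<close> for \<open>x > 1\<close> and
  \<open>x \<mapsto> x / (1 - x)\<close> for \<open>x < 1\<close>. The \<open>q\<close>-deformation turns the inverse branches \<open>x + 1\<close> and
  \<open>x / (x + 1)\<close> into \<open>R f = q f + 1\<close> and \<open>L f = q f / (q f + 1)\<close>, both of which multiply differences of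
  power series by \<open>q\<close>. Rationals near \<open>x\<close> share long initial \<open>T\<close>-itineraries, so their \<open>q\<close>-deformations
  agree to high order: this gives existence and equivariance of \<open>[x]\<^sub>q\<close>.

  For quadratic \<open>x\<close> the \<open>T\<close>-orbit is finite by Lagrange's argument on quadratic forms, so some
  \<open>y = T\<^sup>m x\<close> is fixed by a nonempty word \<open>W\<close> in \<open>R, L\<close>, and \<open>[x]\<^sub>q\<close> is fixed by a conjugate of \<open>W\<close>. The
  fixed point equation has discriminant \<open>(tr W)\<^sup>2 - 4 q\<^sup>n\<close> up to a power of \<open>q\<close>, and \<open>tr W\<close> is a palindrome
  because \<open>W\<close> is conjugate to \<open>q\<^sup>n W(1/q)\<close>.
\<close>

unbundle fps_syntax

section \<open>Finite continued fractions\<close>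

text \<open>Even length makes the dictionary between digits and words exact: for a nonnegative first
  digit, the value on digits a_1, ..., a_2m is R^(a_1) L^(a_2) ... R^(a_(2m-1)) L^(a_(2m) - 1)
  applied to 1. The branch taken at each step depends on the real number alone, so one matrix of
  integer polynomials acts on x at q = 1 and on its deformation. The specialisation q = 1 is carried
  along because it certifies that the lower left entry C is nonzero; with C = 0 the quadratic
  equation, the denominator S and the matrix could all degenerate. The delicate point is the
  palindrome. The intertwining matrix K has determinant q^2 - q + 1, which is not a unit, so its
  determinant is cancelled from a trace identity instead of K being inverted. Moreover, matrices
  conjugated along the preperiod are no longer words. Hence symmetry is proved at the periodic
  point, and only trace, determinant and the data at q = 1 travel back. Adjugates replace inverses
  there to stay inside \<int>[q], at the price of a factor q per step. Nonpositive x is reached from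
  a positive translate by undoing R.\<close>

lemma q_int_add_one:
  assumes "p \<noteq> 0" "p \<noteq> 1"
  shows "q_int p (n + 1) = p * q_int p n + 1"
  using assms by (simp add: q_int_def power_int_add field_simps)

lemma q_int_0 [simp]: "q_int p 0 = 0"
  by (simp add: q_int_def)

lemma q_cfrac_add_one:
  assumes "p \<noteq> 0" "p \<noteq> 1"
  shows "q_cfrac p ((a + 1) # as) = p * q_cfrac p (a # as) + 1"
  using assms q_int_add_one[OF assms, of a]
  by (cases as) (simp_all add: power_int_add algebra_simps)

lemma cfrac_Cons: "as \<noteq> [] \<Longrightarrow> cfrac (a # as) = of_int a + 1 / cfrac as"
  by (cases as) auto

lemma cfrac_add_one: "cfrac ((a + 1) # as) = cfrac (a # as) + 1"
  by (cases as) simp_all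

text \<open>The q-adic filtration, with negative levels allowed. Coefficients are used because
  \<open>fls_subdegree 0 = 0\<close> would misplace the zero series at positive levels.\<close>

definition fls_ge :: "int \<Rightarrow> 'a::zero fls set" where
  "fls_ge k = {f. \<forall>i<k. f $$ i = 0}"

lemma fls_ge_iff: "f \<in> fls_ge k \<longleftrightarrow> f = 0 \<or> k \<le> fls_subdegree f"
  by (auto simp: fls_ge_def intro: fls_subdegree_geI)

lemma fls_ge_mono: "f \<in> fls_ge k \<Longrightarrow> j \<le> k \<Longrightarrow> f \<in> fls_ge j"
  by (auto simp: fls_ge_def)

lemma fls_ge_0 [simp]: "0 \<in> fls_ge k"
  by (simp add: fls_ge_def)

lemma fls_ge_1 [simp]: "1 \<in> fls_ge 0"
  by (simp add: fls_ge_iff)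

lemma fls_ge_add: "f \<in> fls_ge k \<Longrightarrow> g \<in> fls_ge k \<Longrightarrow> f + g \<in> fls_ge k"
  for f g :: "'a::monoid_add fls"
  by (simp add: fls_ge_def)

lemma fls_ge_diff: "f \<in> fls_ge k \<Longrightarrow> g \<in> fls_ge k \<Longrightarrow> f - g \<in> fls_ge k"
  for f g :: "'a::group_add fls"
  by (simp add: fls_ge_def)

lemma fls_ge_mult: "f \<in> fls_ge j \<Longrightarrow> g \<in> fls_ge k \<Longrightarrow> f * g \<in> fls_ge (j + k)"
  for f g :: "'a::idom fls"
  by (cases "f = 0"; cases "g = 0") (auto simp: fls_ge_iff)

lemma fls_ge_X_mult: "f \<in> fls_ge k \<Longrightarrow> fls_X * f \<in> fls_ge (k + 1)"
  for f :: "'a::idom fls"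
  using fls_ge_mult[of fls_X 1 f k] by (simp add: fls_ge_iff add.commute)

section \<open>The deformed branches on power series\<close>

definition q_R :: "'a::field fls \<Rightarrow> 'a fls" where
  "q_R f = fls_X * f + 1"

definition q_L :: "'a::field fls \<Rightarrow> 'a fls" where
  "q_L f = fls_X * f / (fls_X * f + 1)"

text \<open>Constant term 1 makes the denominator of \<open>q_L\<close> a unit power series; this is
  why \<open>q_L\<close> stays inside \<open>fls_ge 0\<close>.\<close>

lemma q_R_nth_0: "f \<in> fls_ge 0 \<Longrightarrow> q_R f $$ 0 = 1"
  using fls_ge_X_mult[of f 0] by (simp add: q_R_def fls_ge_def)

lemma q_R_nonzero: "f \<in> fls_ge 0 \<Longrightarrow> q_R f \<noteq> 0"
  using q_R_nth_0[of f] by auto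

lemma q_R_ge_0: "f \<in> fls_ge 0 \<Longrightarrow> q_R f \<in> fls_ge 0"
  unfolding q_R_def by (intro fls_ge_add fls_ge_1 fls_ge_mono[OF fls_ge_X_mult[of f 0]]) auto

lemma inverse_q_R_ge_0:
  assumes "f \<in> fls_ge 0"
  shows "inverse (q_R f) \<in> fls_ge 0"
proof -
  have "fls_subdegree (q_R f) \<le> 0"
    using q_R_nth_0[OF assms] by (intro fls_subdegree_leI) auto
  moreover have "fls_subdegree (inverse (q_R f)) = - fls_subdegree (q_R f)"
    by simp
  ultimately show ?thesis by (simp only: fls_ge_iff) linarith
qed

lemma q_L_alt: "q_L f = fls_X * f * inverse (q_R f)"
  by (simp only: q_L_def q_R_def divide_inverse)

lemma q_L_ge_0: "f \<in> fls_ge 0 \<Longrightarrow> q_L f \<in> fls_ge 0"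
  unfolding q_L_alt
  using fls_ge_mult[OF fls_ge_X_mult inverse_q_R_ge_0, of f 0 f] fls_ge_mono by force

lemma q_L_nonzero: "f \<in> fls_ge 0 \<Longrightarrow> f \<noteq> 0 \<Longrightarrow> q_L f \<noteq> 0"
  using q_R_nonzero[of f] by (simp add: q_L_alt)

lemma q_R_diff: "f - g \<in> fls_ge k \<Longrightarrow> q_R f - q_R g \<in> fls_ge (k + 1)"
  using fls_ge_X_mult[of "f - g" k] by (simp add: q_R_def algebra_simps)

text \<open>u/(u + 1) - v/(v + 1) = (u - v)/((u + 1)(v + 1)) with u = q f and v = q g; the
  denominators are units, so exactly the factor q is gained.\<close>

lemma q_L_diff:
  assumes "f - g \<in> fls_ge k" "f \<in> fls_ge 0" "g \<in> fls_ge 0"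
  shows "q_L f - q_L g \<in> fls_ge (k + 1)"
proof -
  have "q_L f - q_L g = fls_X * (f - g) * (inverse (q_R f) * inverse (q_R g))"
    using q_R_nonzero[OF assms(2)] q_R_nonzero[OF assms(3)]
    by (simp only: q_L_def q_R_def) (simp add: field_simps)
  moreover have "\<dots> \<in> fls_ge ((k + 1) + (0 + 0))"
    by (intro fls_ge_mult fls_ge_X_mult inverse_q_R_ge_0 assms)
  ultimately show ?thesis by simp
qed

lemma fls_X_neq_1: "(fls_X :: 'a::zero_neq_one fls) \<noteq> 1"
proof
  assume "(fls_X :: 'a fls) = 1"
  then have "(fls_X :: 'a fls) $$ 1 = 1 $$ 1" by simp
  then show False by simp
qed

lemma inverse_fls_X_neq_1: "inverse (fls_X :: 'a::field fls) \<noteq> 1"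
  using fls_X_neq_1[where 'a='a] by (metis inverse_1 inverse_inverse_eq)

lemma q_cfrac_R: "q_cfrac fls_X ((a + 1) # as) = q_R (q_cfrac fls_X (a # as))"
  unfolding q_R_def by (rule q_cfrac_add_one) (simp_all add: fls_X_neq_1)

text \<open>With first digit 0 the value is 1/G, where G has base 1/q. Raising \<open>b\<close> by
  one replaces G by G/q + 1, and in terms of 1/G this is \<open>q_L\<close>. The hypothesis excludes
  G = 0.\<close>

lemma q_cfrac_L:
  assumes "q_cfrac fls_X (0 # b # as) \<noteq> (0 :: 'a::field fls)"
  shows "q_cfrac fls_X (0 # (b + 1) # as) = q_L (q_cfrac fls_X (0 # b # as) :: 'a fls)"
proof -
  define G where "G = q_cfrac (inverse fls_X :: 'a fls) (b # as)"
  have "G \<noteq> 0" using assms by (auto simp: G_def)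
  have *: "q_cfrac (inverse fls_X :: 'a fls) ((b + 1) # as) = inverse fls_X * G + 1"
    unfolding G_def by (rule q_cfrac_add_one) (simp_all add: fls_X_neq_1 del: fls_inverse_X)
  have "1 / (inverse X * G + 1) = X * (1 / G) / (X * (1 / G) + 1)" if "X \<noteq> 0" for X :: "'a fls"
  proof -
    have "inverse X * G + 1 = (G + X) / X" "X * (1 / G) + 1 = (G + X) / G"
      using that \<open>G \<noteq> 0\<close> by (simp_all add: field_simps)
    then show ?thesis using that \<open>G \<noteq> 0\<close> by simp
  qed
  from this[of fls_X] show ?thesis
    unfolding q_L_def by (simp only: q_cfrac.simps(3) * G_def[symmetric]) simp
qed

text \<open>Two zero levels invert twice and return to the base q; this serves as the empty block
  L^0.\<close>

lemma q_cfrac_00: "as \<noteq> [] \<Longrightarrow> q_cfrac q (0 # 0 # as) = q_cfrac q as"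
  by (cases as) auto

lemma funpow_q_R_ge_0: "f \<in> fls_ge 0 \<Longrightarrow> (q_R ^^ n) f \<in> fls_ge 0"
  by (induction n) (auto intro: q_R_ge_0)

lemma funpow_q_R_nonzero:
  assumes "f \<in> fls_ge 0" "f \<noteq> 0"
  shows "(q_R ^^ n) f \<noteq> 0"
  using assms by (cases n) (auto dest: q_R_nonzero[OF funpow_q_R_ge_0])

lemma funpow_q_L_ge_0:
  "f \<in> fls_ge 0 \<Longrightarrow> (q_L ^^ n) f \<in> fls_ge 0"
  by (induction n) (auto intro: q_L_ge_0)

lemma funpow_q_L_nonzero:
  "f \<in> fls_ge 0 \<Longrightarrow> f \<noteq> 0 \<Longrightarrow> (q_L ^^ n) f \<noteq> 0"
  by (induction n) (auto dest: q_L_nonzero[OF funpow_q_L_ge_0])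

lemma q_cfrac_funpow_R:
  "q_cfrac fls_X (int n # as) = (q_R ^^ n) (q_cfrac fls_X (0 # as) :: 'a::field fls)"
proof (induction n)
  case (Suc n)
  then show ?case using q_cfrac_R[of "int n" as, where 'a='a] by (simp only: of_nat_Suc add.commute funpow.simps o_apply)
qed simp

lemma q_cfrac_funpow_L:
  assumes "as \<noteq> []" "(q_cfrac fls_X as :: 'a::field fls) \<in> fls_ge 0" "q_cfrac fls_X as \<noteq> (0 :: 'a fls)"
  shows "q_cfrac fls_X (0 # int n # as) = (q_L ^^ n) (q_cfrac fls_X as :: 'a fls)"
proof (induction n)
  case 0
  then show ?case using q_cfrac_00[OF assms(1)] by (simp only: of_nat_0 funpow.simps id_apply)
next
  case (Suc n)
  have "q_cfrac fls_X (0 # int n # as) \<noteq> (0 :: 'a fls)"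
    unfolding Suc by (rule funpow_q_L_nonzero) (use assms in auto)
  from q_cfrac_L[OF this] Suc show ?case by (simp only: of_nat_Suc add.commute funpow.simps o_apply)
qed

text \<open>The last digit closes an L block on the seed [0, 1], whose value is 1; hence a final
  digit b stands for b - 1 letters.\<close>

lemma q_cfrac_funpow_L_singleton:
  "q_cfrac fls_X [0, 1 + int n] = (q_L ^^ n) (1 :: 'a::field fls)"
proof (induction n)
  case 0
  have "q_int (inverse fls_X :: 'a fls) 1 = 1"
    using inverse_fls_X_neq_1[where 'a='a] by (simp add: q_int_def)
  then show ?case by simp
next
  case (Suc n)
  have "q_cfrac fls_X [0, 1 + int n] \<noteq> (0 :: 'a fls)"
    unfolding Suc by (rule funpow_q_L_nonzero) auto
  from q_cfrac_L[OF this] Suc show ?case by (simp only: of_nat_Suc add_ac funpow.simps o_apply)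
qed

section \<open>Digit lists of even length and uniqueness of expansions\<close>

definition even_digits :: "int list \<Rightarrow> bool" where
  "even_digits as \<longleftrightarrow> as \<noteq> [] \<and> even (length as) \<and> (\<forall>a\<in>set (tl as). a \<ge> 1)"

lemma even_digits_Cons2:
  "even_digits (a # b # as) \<longleftrightarrow> b \<ge> 1 \<and> (as = [] \<or> even_digits as \<and> hd as \<ge> 1)"
  by (cases as) (auto simp: even_digits_def)

lemma even_digits_induct [consumes 1, case_names base step]:
  assumes "even_digits as"
    and "\<And>a b. b \<ge> 1 \<Longrightarrow> P [a, b]"
    and "\<And>a b c as. b \<ge> 1 \<Longrightarrow> c \<ge> 1 \<Longrightarrow> even_digits (c # as) \<Longrightarrow> P (c # as) \<Longrightarrow> P (a # b # c # as)"
  shows "P as"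
  using assms(1)
proof (induction as rule: length_induct)
  case (1 as)
  then obtain a b cs where as: "as = a # b # cs"
    by (cases as rule: cfrac.cases) (auto simp: even_digits_def)
  show ?case
  proof (cases cs)
    case Nil
    then show ?thesis using 1 as assms(2) by (auto simp: even_digits_Cons2)
  next
    case (Cons c ds)
    then show ?thesis using 1 as assms(3)[of b c ds a] by (auto simp: even_digits_Cons2)
  qed
qed

text \<open>The list is a word in R and L applied to 1, and both maps preserve nonzero power series.
  Nonvanishing is part of the induction because \<open>q_cfrac_L\<close> asks for it.\<close>

lemma q_cfrac_even_digits:
  assumes "even_digits as" "hd as \<ge> 0"
  shows "(q_cfrac fls_X as :: 'a fls) \<in> fls_ge 0 \<and> q_cfrac fls_X as \<noteq> (0 :: 'a::field fls)"
  using assms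
proof (induction rule: even_digits_induct)
  case (base a b)
  let ?f = "(q_L ^^ (nat b - 1)) (1 :: 'a fls)"
  have f: "?f \<in> fls_ge 0" "?f \<noteq> 0" by (simp_all add: funpow_q_L_ge_0 funpow_q_L_nonzero)
  have eq: "q_cfrac fls_X [a, b] = (q_R ^^ nat a) ?f"
    using q_cfrac_funpow_R[of "nat a" "[b]", where 'a='a] q_cfrac_funpow_L_singleton[of "nat b - 1", where 'a='a] base
    by (simp add: of_nat_diff)
  show ?case
    using funpow_q_R_ge_0[OF f(1)] funpow_q_R_nonzero[OF f] unfolding eq by simp
next
  case (step a b c as)
  let ?g = "q_cfrac fls_X (c # as) :: 'a fls"
  let ?f = "(q_L ^^ nat b) ?g"
  have g: "?g \<in> fls_ge 0" "?g \<noteq> 0" using step by auto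
  have f: "?f \<in> fls_ge 0" "?f \<noteq> 0" using g by (simp_all add: funpow_q_L_ge_0 funpow_q_L_nonzero)
  have eq: "q_cfrac fls_X (a # b # c # as) = (q_R ^^ nat a) ?f"
    using q_cfrac_funpow_R[of "nat a" "b # c # as", where 'a='a] q_cfrac_funpow_L[of "c # as" "nat b", where 'a='a] g step
    by simp
  show ?case
    using funpow_q_R_ge_0[OF f(1)] funpow_q_R_nonzero[OF f] unfolding eq by simp
qed

lemma q_cfrac_two_steps:
  assumes "even_digits as" "hd as \<ge> 1"
  shows "q_cfrac fls_X (int a # int b # as) = (q_R ^^ a) ((q_L ^^ b) (q_cfrac fls_X as :: 'a::field fls))"
proof -
  have "as \<noteq> []" using assms by (simp add: even_digits_def)
  then show ?thesis
    using q_cfrac_even_digits[OF assms(1), where 'a='a] assms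
    by (subst q_cfrac_funpow_R, subst q_cfrac_funpow_L) auto
qed

text \<open>The interval is open below and closed above since the list a, 1 attains a + 1. So the
  first digit is determined by the value, also at integers, where the even expansion starts one
  below.\<close>

lemma cfrac_even_digits_bounds:
  assumes "even_digits as"
  shows "of_int (hd as) < cfrac as \<and> cfrac as \<le> of_int (hd as) + 1"
  using assms
proof (induction rule: even_digits_induct)
  case (step a b c as)
  have "1 \<le> (of_int b :: rat)" "1 \<le> (of_int c :: rat)" using step by simp_all
  then have "cfrac (c # as) > 1" using step by simp
  then have "of_int b + 1 / cfrac (c # as) \<ge> (1 :: rat)"
    using \<open>1 \<le> of_int b\<close> by (intro add_increasing2) simp_all
  then show ?case by (simp add: cfrac_Cons)
qed simp

lemma of_int_less_le_unique:
  "of_int a < y \<Longrightarrow> y \<le> of_int a + 1 \<Longrightarrow> of_int b < y \<Longrightarrow> y \<le> of_int b + 1 \<Longrightarrow> a = b"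
  for y :: "'a::linordered_idom"
proof -
  assume "of_int a < y" "y \<le> of_int a + 1" "of_int b < y" "y \<le> of_int b + 1"
  then have "(of_int a :: 'a) < of_int (b + 1)" "(of_int b :: 'a) < of_int (a + 1)"
    by simp_all
  then show ?thesis by (simp only: of_int_less_iff)
qed

lemma cfrac_tail_gt_1:
  assumes "even_digits (c # as)" "c \<ge> 1"
  shows "cfrac (c # as) > 1"
proof -
  have "1 \<le> (of_int c :: rat)" using assms by simp
  then show ?thesis using cfrac_even_digits_bounds[OF assms(1)] by simp
qed

lemma of_int_add_inverse_unique:
  fixes u v :: rat
  assumes "of_int b + 1 / u = of_int b' + 1 / v" "u > 1" "v > 1"
  shows "b = b' \<and> u = v"
proof -
  have *: "0 < 1 / u" "1 / u < 1" "0 < 1 / v" "1 / v < 1" using assms by simp_all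
  have "b = b'"
    by (rule of_int_less_le_unique[of b "of_int b + 1 / u"]) (use * assms(1) in \<open>linarith+\<close>)
  then show ?thesis using assms by simp
qed

lemma of_int_add_inverse_neq: "of_int b + 1 / u \<noteq> of_int b'" if "u > 1" for u :: rat
proof
  assume eq: "of_int b + 1 / u = of_int b'"
  have *: "0 < 1 / u" "1 / u < 1" using that by simp_all
  have "(of_int b :: rat) < of_int b'" using eq * by linarith
  moreover have "(of_int b' :: rat) < of_int (b + 1)"
    using eq * unfolding of_int_add of_int_1 by linarith
  ultimately show False by (simp only: of_int_less_iff)
qed

lemma even_digits_cases:
  assumes "even_digits as"
  obtains a b cs where "as = a # b # cs" "b \<ge> 1"
    "cs = [] \<or> even_digits cs \<and> cs \<noteq> [] \<and> hd cs \<ge> 1 \<and> cfrac cs > 1"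
proof -
  obtain a b cs where as: "as = a # b # cs"
    using assms by (cases as rule: cfrac.cases) (auto simp: even_digits_def)
  show ?thesis
    using that[OF as] assms cfrac_tail_gt_1[of "hd cs" "tl cs"]
    by (cases cs) (auto simp: as even_digits_Cons2)
qed

text \<open>The half-open unit interval fixes the first digit. After removing it, a list that stops
  at \<open>b\<close> has an integer value, whereas a longer one adds 1/u with u > 1 and never
  reaches an integer; in the remaining case both second digits and both tails agree.\<close>

lemma cfrac_even_digits_inj:
  assumes "even_digits as" "even_digits bs" "cfrac as = cfrac bs"
  shows "as = bs"
  using assms
proof (induction as arbitrary: bs rule: length_induct)
  case (1 as)
  obtain a b cs where as: "as = a # b # cs" "b \<ge> 1"
      "cs = [] \<or> even_digits cs \<and> cs \<noteq> [] \<and> hd cs \<ge> 1 \<and> cfrac cs > 1"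
    using even_digits_cases[OF \<open>even_digits as\<close>] .
  obtain a' b' cs' where bs: "bs = a' # b' # cs'" "b' \<ge> 1"
      "cs' = [] \<or> even_digits cs' \<and> cs' \<noteq> [] \<and> hd cs' \<ge> 1 \<and> cfrac cs' > 1"
    using even_digits_cases[OF \<open>even_digits bs\<close>] .
  have "hd as = hd bs"
    using cfrac_even_digits_bounds[OF 1(2)] cfrac_even_digits_bounds[OF 1(3)] unfolding 1(4)
    by (intro of_int_less_le_unique[of "hd as" "cfrac bs" "hd bs"]) auto
  then have [simp]: "a' = a" by (simp add: as(1) bs(1))
  have eq: "cfrac (b # cs) = cfrac (b' # cs')"
    using 1(4) by (simp add: as(1) bs(1))
  consider "cs = []" "cs' = []" | "cs = []" "cs' \<noteq> []" | "cs \<noteq> []" "cs' = []" | "cs \<noteq> []" "cs' \<noteq> []"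
    by blast
  then show ?case
  proof cases
    case 1
    then show ?thesis using eq by (simp add: as(1) bs(1))
  next
    case 2
    then show ?thesis
      using eq bs(3) of_int_add_inverse_neq[of "cfrac cs'" b' b] by (simp add: cfrac_Cons)
  next
    case 3
    then show ?thesis
      using eq as(3) of_int_add_inverse_neq[of "cfrac cs" b b'] by (simp add: cfrac_Cons)
  next
    case 4
    then have "b = b' \<and> cfrac cs = cfrac cs'"
      using eq as(3) bs(3) by (intro of_int_add_inverse_unique) (auto simp: cfrac_Cons)
    moreover from this have "cs = cs'"
      using "1.IH" as bs(3) 4 by (auto simp: as(1))
    ultimately show ?thesis by (simp add: as(1) bs(1))
  qed
qed

section \<open>Existence of even expansions and equivariance of deformed rationals\<close>

lemma even_expansion_iff: "even_expansion y as \<longleftrightarrow> even_digits as \<and> cfrac as = y"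
  by (auto simp: even_expansion_def even_digits_def)

lemma q_rat_eqI: "even_expansion y as \<Longrightarrow> q_rat y = q_cfrac fls_X as"
  unfolding q_rat_def even_expansion_iff
  by (subst the_equality[where a = as]) (auto intro: cfrac_even_digits_inj)

lemma even_expansion_shift:
  "even_expansion y (a # as) \<Longrightarrow> even_expansion (y + of_int k) ((a + k) # as)"
  by (cases as) (auto simp: even_expansion_def)

lemma even_expansion_hd_nonneg:
  assumes "even_expansion y as" "y > 0"
  shows "hd as \<ge> 0"
proof -
  have "(of_int 0 :: rat) < of_int (hd as + 1)"
    using cfrac_even_digits_bounds[of as] assms by (auto simp: even_expansion_iff)
  then show ?thesis by (simp only: of_int_less_iff)
qed

text \<open>The branch y/(y + 1) adds 1 to 1/y. A positive first digit therefore receives a new pair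
  0, 1 in front, whereas behind a first digit 0 the second digit is raised.\<close>

lemma even_expansion_L_pos:
  assumes "even_expansion y (a # as)" "y > 0" "a \<ge> 1"
  shows "even_expansion (y / (y + 1)) (0 # 1 # a # as)"
  using assms by (auto simp: even_expansion_def cfrac_Cons field_simps)

lemma even_expansion_L_0:
  assumes "even_expansion y (0 # b # as)" "y > 0"
  shows "even_expansion (y / (y + 1)) (0 # (b + 1) # as)"
proof -
  have "1 / y = cfrac (b # as)"
    using assms by (auto simp: even_expansion_def)
  then have "cfrac (0 # (b + 1) # as) = 1 / (1 / y + 1)"
    by (simp only: cfrac.simps cfrac_add_one of_int_0 add_0)
  also have "\<dots> = y / (y + 1)"
    using \<open>y > 0\<close> by (simp add: field_simps)
  finally show ?thesis
    using assms(1) by (auto simp: even_expansion_def)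
qed

lemma even_expansion_L_exists:
  assumes "even_expansion y as" "y > 0"
  shows "\<exists>bs. even_expansion (y / (y + 1)) bs"
proof -
  obtain a b cs where "as = a # b # cs"
    using assms even_digits_cases[of as] unfolding even_expansion_iff by metis
  then show ?thesis
    using even_expansion_hd_nonneg[OF assms] even_expansion_L_0[of y b cs]
      even_expansion_L_pos[of y a "b # cs"] assms
    by (cases "a = 0") auto
qed

text \<open>Subtractive Euclidean algorithm, run backwards from 1 = [0, 1].\<close>

lemma even_expansion_exists_pos: "m > 0 \<Longrightarrow> n > 0 \<Longrightarrow> \<exists>as. even_expansion (of_nat m / of_nat n) as"
proof (induction "m + n" arbitrary: m n rule: less_induct)
  case less
  consider "m = n" | "m > n" | "m < n" by linarith
  then show ?case
  proof cases
    case 1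
    then have "even_expansion (of_nat m / of_nat n) [0, 1]"
      using less by (simp add: even_expansion_def)
    then show ?thesis by blast
  next
    case 2
    then obtain as where as: "even_expansion (of_nat (m - n) / of_nat n) as"
      using less(1)[of "m - n" n] less(2-3) by auto
    then have "as = hd as # tl as" by (simp add: even_expansion_def)
    then have "even_expansion (of_nat (m - n) / of_nat n + of_int 1) ((hd as + 1) # tl as)"
      using even_expansion_shift as by metis
    moreover have "of_nat (m - n) / of_nat n + of_int 1 = (of_nat m / of_nat n :: rat)"
      using less 2 by (simp add: of_nat_diff field_simps)
    ultimately show ?thesis by auto
  next
    case 3
    then obtain as where as: "even_expansion (of_nat m / of_nat (n - m)) as"
      using less(1)[of m "n - m"] less(2-3) by auto
    have *: "(of_nat (n - m) :: rat) > 0" "(of_nat (n - m) :: rat) = of_nat n - of_nat m"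
      using 3 by (simp_all add: of_nat_diff)
    have pos: "of_nat m / of_nat (n - m) > (0 :: rat)"
      using less 3 by simp
    have eq: "of_nat m / of_nat (n - m) / (of_nat m / of_nat (n - m) + 1) = (of_nat m / of_nat n :: rat)"
      using less(2,3) * by (simp add: field_simps)
    from even_expansion_L_exists[OF as pos] show ?thesis unfolding eq .
  qed
qed

lemma even_expansion_exists: "\<exists>as. even_expansion y as"
proof -
  obtain k :: int where "- y < of_int k" using ex_less_of_int by blast
  then have k: "y + of_int k > 0" by linarith
  obtain m n where "quotient_of (y + of_int k) = (m, n)" by force
  then have mn: "y + of_int k = of_int m / of_int n" "n > 0"
    using quotient_of_div quotient_of_denom_pos by blast+
  with k have "m > 0" by (simp add: zero_less_divide_iff)
  then have "y + of_int k = of_nat (nat m) / of_nat (nat n)" using mn by simp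
  then obtain as where as: "even_expansion (y + of_int k) as"
    using even_expansion_exists_pos[of "nat m" "nat n"] mn(2) \<open>m > 0\<close> by auto
  then have "as = hd as # tl as" by (simp add: even_expansion_def)
  then show ?thesis
    using even_expansion_shift[of "y + of_int k" "hd as" "tl as" "-k"] as by auto
qed

lemma q_rat_add_one: "q_rat (y + 1) = q_R (q_rat y)"
proof -
  obtain as where as: "even_expansion y as" using even_expansion_exists by blast
  then have hd: "as = hd as # tl as" by (simp add: even_expansion_def)
  have "q_rat (y + 1) = q_cfrac fls_X ((hd as + 1) # tl as)"
    using even_expansion_shift[of y "hd as" "tl as" 1] as hd by (intro q_rat_eqI) simp
  also have "\<dots> = q_R (q_cfrac fls_X as)"
    using q_cfrac_R hd by metis
  finally show ?thesis using q_rat_eqI[OF as] by simp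
qed

lemma q_rat_ge_0:
  assumes "y > 0"
  shows "q_rat y \<in> fls_ge 0"
proof -
  obtain as where as: "even_expansion y as" using even_expansion_exists by blast
  then show ?thesis
    using q_cfrac_even_digits[of as, where 'a=rat] even_expansion_hd_nonneg[OF as assms] q_rat_eqI[OF as]
    by (simp add: even_expansion_iff)
qed

lemma q_rat_L:
  assumes "y > 0"
  shows "q_rat (y / (y + 1)) = q_L (q_rat y)"
proof -
  obtain as where as: "even_expansion y as" using even_expansion_exists by blast
  obtain a b cs where abc: "as = a # b # cs"
    using as even_digits_cases[of as] unfolding even_expansion_iff by metis
  note nz = q_cfrac_even_digits[of as, where 'a=rat, OF _ even_expansion_hd_nonneg[OF as assms]]
  show ?thesis
  proof (cases "a = 0")
    case True
    then have "q_rat (y / (y + 1)) = q_cfrac fls_X (0 # (b + 1) # cs)"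
      using even_expansion_L_0[of y b cs] as abc assms by (intro q_rat_eqI) simp
    also have "\<dots> = q_L (q_cfrac fls_X as)"
      using nz as abc True unfolding even_expansion_iff by (subst q_cfrac_L) auto
    finally show ?thesis using q_rat_eqI[OF as] by simp
  next
    case False
    then have "a \<ge> 1" using even_expansion_hd_nonneg[OF as assms] abc by simp
    then have "q_rat (y / (y + 1)) = q_cfrac fls_X (0 # int 1 # as)"
      using even_expansion_L_pos[of y a "b # cs"] as abc assms by (intro q_rat_eqI) simp
    also have "\<dots> = q_L (q_cfrac fls_X as)"
      using nz as abc unfolding even_expansion_iff by (subst q_cfrac_funpow_L) auto
    finally show ?thesis using q_rat_eqI[OF as] by simp
  qed
qed

section \<open>Deformations of irrationals\<close>

text \<open>A filter in place of sequences, so that the branches of the slow map become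
  \<open>filterlim\<close> statements that can be composed.\<close>

definition rat_nhds :: "real \<Rightarrow> rat filter" where
  "rat_nhds x = filtercomap of_rat (nhds x)"

text \<open>All coefficients below \<open>k\<close> agree at once, including the infinitely many
  negative indices. This uniform version of \<open>stabilizes_to\<close> survives multiplication and
  division.\<close>

definition q_limit :: "real \<Rightarrow> rat fls \<Rightarrow> bool" where
  "q_limit x f \<longleftrightarrow> (\<forall>k. \<forall>\<^sub>F y in rat_nhds x. f - q_rat y \<in> fls_ge k)"

lemma of_rat_tendsto: "(of_rat \<longlongrightarrow> x) (rat_nhds x)"
  unfolding rat_nhds_def by (rule filterlim_filtercomap)

lemma filterlim_rat_nhds_iff: "filterlim f (rat_nhds x) F \<longleftrightarrow> ((\<lambda>y. of_rat (f y)) \<longlongrightarrow> x) F"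
  unfolding rat_nhds_def filterlim_filtercomap_iff by (simp add: o_def)

lemma ex_rat_seq: "\<exists>xs :: nat \<Rightarrow> rat. (\<lambda>n. of_rat (xs n)) \<longlonglongrightarrow> (x :: real)"
proof -
  have "\<exists>r :: rat. x < of_rat r \<and> of_rat r < x + 1 / real (Suc n)" for n
    by (rule of_rat_dense) simp
  then obtain xs :: "nat \<Rightarrow> rat" where xs: "x < of_rat (xs n)" "of_rat (xs n) < x + 1 / real (Suc n)" for n
    by metis
  have upper: "(\<lambda>n. x + 1 / real (Suc n)) \<longlonglongrightarrow> x"
    using tendsto_add[OF tendsto_const[of x] LIMSEQ_inverse_real_of_nat]
    by (simp only: inverse_eq_divide add_0_right)
  have "(\<lambda>n. of_rat (xs n)) \<longlonglongrightarrow> x"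
    by (rule real_tendsto_sandwich[OF _ _ tendsto_const upper])
      (rule always_eventually, rule allI, rule less_imp_le, rule xs)+
  then show ?thesis by (rule exI[of _ xs])
qed

text \<open>Density of the rationals; it prevents eventual statements along this filter from being
  vacuous.\<close>

lemma rat_nhds_neq_bot: "rat_nhds x \<noteq> bot"
proof
  assume bot: "rat_nhds x = bot"
  obtain xs :: "nat \<Rightarrow> rat" where "(\<lambda>n. of_rat (xs n)) \<longlonglongrightarrow> x"
    using ex_rat_seq[of x] by blast
  then have "filterlim xs (rat_nhds x) sequentially"
    by (simp only: filterlim_rat_nhds_iff)
  moreover have "\<forall>\<^sub>F y in rat_nhds x. False"
    by (simp only: bot eventually_bot)
  ultimately have "\<forall>\<^sub>F n :: nat in sequentially. False"
    by (rule eventually_compose_filterlim[rotated])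
  then show False by simp
qed

lemma q_limit_stabilizes:
  assumes "q_limit x f" "(\<lambda>n. of_rat (xs n)) \<longlonglongrightarrow> x"
  shows "stabilizes_to (\<lambda>n. q_rat (xs n)) f"
  unfolding stabilizes_to_def
proof
  fix k
  have "filterlim xs (rat_nhds x) sequentially"
    using assms(2) by (simp add: filterlim_rat_nhds_iff)
  moreover have "\<forall>\<^sub>F y in rat_nhds x. f - q_rat y \<in> fls_ge (k + 1)"
    using assms(1) by (simp add: q_limit_def)
  ultimately have "\<forall>\<^sub>F n in sequentially. f - q_rat (xs n) \<in> fls_ge (k + 1)"
    by (rule eventually_compose_filterlim[rotated])
  then show "\<forall>\<^sub>F n in sequentially. q_rat (xs n) $$ k = f $$ k"
    by eventually_elim (simp add: fls_ge_def)
qed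

lemma stabilizes_to_unique:
  assumes "stabilizes_to F f" "stabilizes_to F g"
  shows "f = g"
proof (rule fls_eqI)
  fix k
  have "\<forall>\<^sub>F n in sequentially. f $$ k = g $$ k"
    using assms[unfolded stabilizes_to_def, rule_format, of k] by eventually_elim simp
  then show "f $$ k = g $$ k" by simp
qed

text \<open>Uniqueness in the description rests on the existence of at least one rational sequence
  tending to \<open>x\<close>.\<close>

lemma q_irrat_eqI:
  assumes "q_limit x f"
  shows "q_irrat x = f"
  unfolding q_irrat_def
proof (rule the_equality)
  show "\<forall>xs :: nat \<Rightarrow> rat. (\<lambda>n. of_rat (xs n)) \<longlonglongrightarrow> x \<longrightarrow> stabilizes_to (\<lambda>n. q_rat (xs n)) f"
    using q_limit_stabilizes[OF assms] by blast
  fix g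
  assume g: "\<forall>xs :: nat \<Rightarrow> rat. (\<lambda>n. of_rat (xs n)) \<longlonglongrightarrow> x \<longrightarrow> stabilizes_to (\<lambda>n. q_rat (xs n)) g"
  obtain xs :: "nat \<Rightarrow> rat" where "(\<lambda>n. of_rat (xs n)) \<longlonglongrightarrow> x"
    using ex_rat_seq by blast
  then show "g = f"
    using g q_limit_stabilizes[OF assms] stabilizes_to_unique by blast
qed

section \<open>Existence and equivariance of the limit at an irrational\<close>

lemma eventually_rat_nhds_pos:
  assumes "x > 0"
  shows "\<forall>\<^sub>F y in rat_nhds x. y > 0"
  using order_tendstoD(1)[OF of_rat_tendsto assms] by simp

lemma filterlim_rat_nhds_R: "filterlim (\<lambda>y. y - 1) (rat_nhds (x - 1)) (rat_nhds x)"
  unfolding filterlim_rat_nhds_iff of_rat_diff of_rat_1 by (intro tendsto_intros of_rat_tendsto)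

lemma filterlim_rat_nhds_L:
  assumes "x \<noteq> 1"
  shows "filterlim (\<lambda>y. y / (1 - y)) (rat_nhds (x / (1 - x))) (rat_nhds x)"
  unfolding filterlim_rat_nhds_iff of_rat_diff of_rat_1 of_rat_divide
  using assms by (intro tendsto_intros of_rat_tendsto) simp_all

lemma eventually_approx_R:
  assumes "\<forall>\<^sub>F y in rat_nhds (x - 1). g - q_rat y \<in> fls_ge k"
  shows "\<forall>\<^sub>F y in rat_nhds x. q_R g - q_rat y \<in> fls_ge (k + 1)"
proof -
  have "\<forall>\<^sub>F y in rat_nhds x. g - q_rat (y - 1) \<in> fls_ge k"
    using assms filterlim_rat_nhds_R by (rule eventually_compose_filterlim)
  then show ?thesis
  proof eventually_elim
    case (elim y)
    then show ?case using q_R_diff[of g "q_rat (y - 1)" k] q_rat_add_one[of "y - 1"] by simp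
  qed
qed

lemma eventually_approx_L:
  assumes "\<forall>\<^sub>F y in rat_nhds (x / (1 - x)). g - q_rat y \<in> fls_ge k" "0 < x" "x < 1" "g \<in> fls_ge 0"
  shows "\<forall>\<^sub>F y in rat_nhds x. q_L g - q_rat y \<in> fls_ge (k + 1)"
proof -
  have *: "\<forall>\<^sub>F y in rat_nhds x. g - q_rat (y / (1 - y)) \<in> fls_ge k"
    using assms(1) filterlim_rat_nhds_L by (rule eventually_compose_filterlim) (use assms in auto)
  have "\<forall>\<^sub>F y in rat_nhds (x / (1 - x)). y > 0"
    by (rule eventually_rat_nhds_pos) (use assms in auto)
  then have "\<forall>\<^sub>F y in rat_nhds x. y / (1 - y) > 0"
    using filterlim_rat_nhds_L by (rule eventually_compose_filterlim) (use assms in auto)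
  with * show ?thesis
  proof eventually_elim
    case (elim y)
    then have "0 < y" "y < 1" by (auto simp: zero_less_divide_iff)
    then have "y / (1 - y) / (y / (1 - y) + 1) = y"
      by (simp add: field_simps)
    then show ?case
      using q_L_diff[OF elim(1) assms(4) q_rat_ge_0[OF elim(2)]] q_rat_L[OF elim(2)] by simp
  qed
qed

lemma irrational_R: "x \<notin> \<rat> \<Longrightarrow> x - 1 \<notin> \<rat>" for x :: real
  by (metis Rats_1 Rats_add diff_add_cancel)

lemma irrational_L:
  fixes x :: real
  assumes "x \<notin> \<rat>"
  shows "x / (1 - x) \<notin> \<rat>"
proof
  assume r: "x / (1 - x) \<in> \<rat>"
  have "x \<noteq> 1" using assms by auto
  then have "x = (x / (1 - x)) / (1 + x / (1 - x))" by (simp add: field_simps)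
  also have "\<dots> \<in> \<rat>" by (intro Rats_divide Rats_add Rats_1 r)
  finally show False using assms by simp
qed

text \<open>The approximant is a word of \<open>n\<close> letters applied to 0. It starts with
  precision 0, because deformations of positive rationals are power series, and gains one order per
  letter.\<close>

lemma q_approx_exists:
  assumes "x \<notin> \<rat>" "x > 0"
  shows "\<exists>g\<in>fls_ge 0. \<forall>\<^sub>F y in rat_nhds x. g - q_rat y \<in> fls_ge (int n)"
  using assms
proof (induction n arbitrary: x)
  case 0
  have "\<forall>\<^sub>F y in rat_nhds x. 0 - q_rat y \<in> fls_ge (int 0)"
    using eventually_rat_nhds_pos[OF 0(2)]
    by eventually_elim (simp only: of_nat_0, intro fls_ge_diff fls_ge_0 q_rat_ge_0)
  then show ?case by (intro bexI[of _ 0]) simp_all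
next
  case (Suc n)
  have "x \<noteq> 1" using Suc.prems by auto
  then consider "x > 1" | "x < 1" by linarith
  then show ?case
  proof cases
    case 1
    then obtain g where "g \<in> fls_ge 0" "\<forall>\<^sub>F y in rat_nhds (x - 1). g - q_rat y \<in> fls_ge (int n)"
      using Suc.IH[of "x - 1"] Suc.prems irrational_R by auto
    then show ?thesis
      using eventually_approx_R[of g "int n" x] q_R_ge_0[of g] by (auto simp: add.commute)
  next
    case 2
    then obtain g where "g \<in> fls_ge 0" "\<forall>\<^sub>F y in rat_nhds (x / (1 - x)). g - q_rat y \<in> fls_ge (int n)"
      using Suc.IH[of "x / (1 - x)"] Suc.prems irrational_L by auto
    then show ?thesis
      using eventually_approx_L[of g "int n" x] q_L_ge_0[of g] Suc.prems 2 by (auto simp: add.commute)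
  qed
qed

lemma q_limit_exists_pos:
  assumes "x \<notin> \<rat>" "x > 0"
  shows "\<exists>f\<in>fls_ge 0. q_limit x f"
proof -
  obtain g where g: "g n \<in> fls_ge 0" "\<forall>\<^sub>F y in rat_nhds x. g n - q_rat y \<in> fls_ge (int n)" for n
    using q_approx_exists[OF assms] by metis
  \<comment> \<open>Two approximants are compared through a common rational y near \<open>x\<close>,
    which exists because the filter is nontrivial.\<close>
  have agree: "g m $$ k = g n $$ k" if "k < int m" "k < int n" for m n k
  proof -
    have "\<forall>\<^sub>F y in rat_nhds x. g m $$ k = g n $$ k"
      using g(2)[of m] g(2)[of n]
    proof eventually_elim
      case (elim y)
      then have "(g m - q_rat y) $$ k = 0" "(g n - q_rat y) $$ k = 0"
        using that by (simp_all only: fls_ge_def mem_Collect_eq)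
      then show ?case by simp
    qed
    then show ?thesis using rat_nhds_neq_bot by (simp add: eventually_const)
  qed
  \<comment> \<open>Index \<open>Suc k\<close>: precision k + 1 is the first that settles the
    coefficient of index k.\<close>
  define f where "f = fps_to_fls (Abs_fps (\<lambda>k. g (Suc k) $$ int k))"
  have f: "f $$ k = g n $$ k" if "k < int n" for k n
  proof (cases "k < 0")
    case True
    then show ?thesis using g(1)[of n] by (simp add: f_def fls_ge_def)
  next
    case False
    then have "f $$ k = g (Suc (nat k)) $$ k" by (simp add: f_def)
    also have "\<dots> = g n $$ k" using False that by (intro agree) simp_all
    finally show ?thesis .
  qed
  have "\<forall>\<^sub>F y in rat_nhds x. f - q_rat y \<in> fls_ge k" for k
    using g(2)[of "nat k"]
  proof eventually_elim
    case (elim y)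
    have "(f - q_rat y) $$ i = 0" if "i < k" for i
    proof -
      have "f $$ i = g (nat k) $$ i" using that by (intro f) linarith
      moreover have "i < int (nat k)" using that by linarith
      ultimately show ?thesis using elim by (simp add: fls_ge_def)
    qed
    then show ?case by (simp add: fls_ge_def)
  qed
  then have "q_limit x f" by (simp only: q_limit_def) blast
  moreover have "f \<in> fls_ge 0" by (simp add: f_def fls_ge_def)
  ultimately show ?thesis ..
qed

lemma q_limit_R:
  assumes "q_limit (x - 1) f"
  shows "q_limit x (q_R f)"
  unfolding q_limit_def
proof
  fix k
  have "\<forall>\<^sub>F y in rat_nhds (x - 1). f - q_rat y \<in> fls_ge (k - 1)"
    using assms by (simp only: q_limit_def)
  from eventually_approx_R[OF this] show "\<forall>\<^sub>F y in rat_nhds x. q_R f - q_rat y \<in> fls_ge k"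
    by (simp only: diff_add_cancel)
qed

lemma q_limit_L:
  assumes "q_limit (x / (1 - x)) f" "0 < x" "x < 1" "f \<in> fls_ge 0"
  shows "q_limit x (q_L f)"
  unfolding q_limit_def
proof
  fix k
  have "\<forall>\<^sub>F y in rat_nhds (x / (1 - x)). f - q_rat y \<in> fls_ge (k - 1)"
    using assms(1) by (simp only: q_limit_def)
  from eventually_approx_L[OF this assms(2-4)] show "\<forall>\<^sub>F y in rat_nhds x. q_L f - q_rat y \<in> fls_ge k"
    by (simp only: diff_add_cancel)
qed

text \<open>Dividing by q costs one order of precision, harmless because every order is available.
  This is how negative powers of q enter for nonpositive \<open>x\<close>.\<close>

lemma q_limit_inverse_R:
  assumes "q_limit (x + 1) f"
  shows "q_limit x ((f - 1) / fls_X)"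
  unfolding q_limit_def
proof
  fix k
  have "filterlim (\<lambda>y. y + 1) (rat_nhds (x + 1)) (rat_nhds x)"
    unfolding filterlim_rat_nhds_iff of_rat_add of_rat_1 by (intro tendsto_intros of_rat_tendsto)
  moreover have "\<forall>\<^sub>F y in rat_nhds (x + 1). f - q_rat y \<in> fls_ge (k + 1)"
    using assms by (simp add: q_limit_def)
  ultimately have "\<forall>\<^sub>F y in rat_nhds x. f - q_rat (y + 1) \<in> fls_ge (k + 1)"
    by (rule eventually_compose_filterlim[rotated])
  then show "\<forall>\<^sub>F y in rat_nhds x. (f - 1) / fls_X - q_rat y \<in> fls_ge k"
  proof eventually_elim
    case (elim y)
    have inv: "inverse (fls_X :: rat fls) \<in> fls_ge (-1)"
      by (simp add: fls_ge_iff)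
    have "(f - 1) / fls_X - q_rat y = (f - q_rat (y + 1)) * inverse fls_X"
      unfolding q_rat_add_one q_R_def divide_inverse by (simp add: algebra_simps del: fls_inverse_X)
    also have "\<dots> \<in> fls_ge (k + 1 + -1)"
      by (intro fls_ge_mult elim inv)
    finally show ?case by simp
  qed
qed

lemma q_limit_exists:
  assumes "x \<notin> \<rat>"
  shows "\<exists>f. q_limit x f"
proof -
  have "\<exists>f. q_limit (x - real n) f" if "x > 0" "x \<notin> \<rat>" for x n
  proof (induction n)
    case 0
    then show ?case using q_limit_exists_pos[OF that(2,1)] by auto
  next
    case (Suc n)
    then show ?case using q_limit_inverse_R[of "x - real (Suc n)"] by auto
  qed
  moreover obtain n where "real n > - x"
    using reals_Archimedean2 by blast
  then have "x + real n > 0" by simp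
  moreover have "x + real n \<notin> \<rat>"
    using assms by (metis Rats_diff Rats_of_nat add_diff_cancel_right')
  ultimately have "\<exists>f. q_limit (x + real n - real n) f" by blast
  then show ?thesis by simp
qed

lemma q_limit_q_irrat: "x \<notin> \<rat> \<Longrightarrow> q_limit x (q_irrat x)"
  using q_limit_exists[of x] q_irrat_eqI[of x] by auto

lemma q_irrat_ge_0: "x \<notin> \<rat> \<Longrightarrow> x > 0 \<Longrightarrow> q_irrat x \<in> fls_ge 0"
  using q_limit_exists_pos[of x] q_irrat_eqI[of x] by auto

lemma q_irrat_R: "x \<notin> \<rat> \<Longrightarrow> q_irrat x = q_R (q_irrat (x - 1))"
  by (intro q_irrat_eqI q_limit_R q_limit_q_irrat irrational_R)

lemma q_irrat_L: "x \<notin> \<rat> \<Longrightarrow> 0 < x \<Longrightarrow> x < 1 \<Longrightarrow> q_irrat x = q_L (q_irrat (x / (1 - x)))"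
  by (intro q_irrat_eqI q_limit_L q_limit_q_irrat q_irrat_ge_0 irrational_L) auto

section \<open>The slow continued fraction map on quadratic irrationals\<close>

definition slow_step :: "real \<Rightarrow> real" where
  "slow_step x = (if x > 1 then x - 1 else x / (1 - x))"

lemma slow_step_irrational: "x \<notin> \<rat> \<Longrightarrow> slow_step x \<notin> \<rat>"
  by (simp add: slow_step_def irrational_R irrational_L)

lemma slow_step_pos: "x \<notin> \<rat> \<Longrightarrow> x > 0 \<Longrightarrow> slow_step x > 0"
proof -
  assume "x \<notin> \<rat>" "x > 0"
  moreover from this have "x \<noteq> 1" by auto
  ultimately show ?thesis by (auto simp: slow_step_def)
qed

lemma funpow_slow_step:
  assumes "x \<notin> \<rat>" "x > 0"
  shows "(slow_step ^^ n) x \<notin> \<rat>" "(slow_step ^^ n) x > 0"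
  using assms by (induction n) (auto simp: slow_step_irrational slow_step_pos)

definition quadratic_root :: "int \<Rightarrow> int \<Rightarrow> int \<Rightarrow> real \<Rightarrow> bool" where
  "quadratic_root a b c x \<longleftrightarrow> of_int a * x\<^sup>2 + of_int b * x + of_int c = 0"

lemma linear_rational_root:
  assumes "of_int b * x + of_int c = (0 :: real)" "x \<notin> \<rat>"
  shows "b = 0 \<and> c = 0"
proof -
  have "b = 0"
  proof (rule ccontr)
    assume "b \<noteq> 0"
    then have "x = - of_int c / of_int b" using assms(1) by (simp add: field_simps)
    also have "\<dots> \<in> \<rat>" by (intro Rats_divide) auto
    finally show False using assms(2) by simp
  qed
  then show ?thesis using assms(1) by simp
qed

lemma quadratic_root_R:
  assumes "quadratic_root a b c x"
  shows "quadratic_root a (b + 2 * a) (a + b + c) (x - 1)"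
  using assms by (simp add: quadratic_root_def power2_eq_square algebra_simps)

lemma quadratic_root_L:
  assumes "quadratic_root a b c x" "x \<noteq> 1"
  shows "quadratic_root (a + b + c) (b + 2 * c) c (x / (1 - x))"
proof -
  define y where "y = x / (1 - x)"
  have x: "x = y / (1 + y)" "1 + y = 1 / (1 - x)" "1 + y \<noteq> 0"
    using assms(2) by (auto simp: y_def field_simps)
  have "0 = (of_int a * x\<^sup>2 + of_int b * x + of_int c) * (1 + y)\<^sup>2"
    using assms(1) by (simp add: quadratic_root_def)
  also have "\<dots> = of_int a * (x * (1 + y))\<^sup>2 + of_int b * (x * (1 + y)) * (1 + y) + of_int c * (1 + y)\<^sup>2"
    by (simp add: power2_eq_square algebra_simps)
  also have "x * (1 + y) = y" using x by (metis nonzero_eq_divide_eq)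
  finally show ?thesis
    unfolding y_def[symmetric] by (simp add: quadratic_root_def power2_eq_square algebra_simps)
qed

lemma quadratic_root_nonzero:
  assumes "quadratic_root a b c x" "x \<notin> \<rat>" "a \<noteq> 0"
  shows "c \<noteq> 0"
proof
  assume "c = 0"
  then have "x * (of_int a * x + of_int b) = 0"
    using assms(1) by (simp add: quadratic_root_def power2_eq_square algebra_simps)
  moreover have "x \<noteq> 0" using assms(2) by auto
  ultimately show False using linear_rational_root[of a x b] assms by simp
qed

text \<open>Here \<open>w / a\<close> is the conjugate root.\<close>

lemma quadratic_value_at_1:
  assumes "quadratic_root a b c x" "x \<noteq> 0" "of_int c = w * x"
  shows "of_int (a + b + c) = (1 - x) * (of_int a - w)"
proof -
  have "x * (of_int a * x + of_int b + w) = 0"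
    using assms(1,3) by (simp add: quadratic_root_def power2_eq_square algebra_simps)
  then have "of_int b = - w - of_int a * x" using assms(2) by simp
  then show ?thesis using assms(3) by (simp add: algebra_simps)
qed

text \<open>\<open>a * c < 0\<close> says that the conjugate root is negative, and both branches map
  negative numbers to negative numbers. The substitutions are unimodular, so the discriminant is
  kept.\<close>

lemma slow_step_quadratic_indefinite:
  assumes "quadratic_root a b c x" "x \<notin> \<rat>" "x > 0" "a * c < 0"
  shows "\<exists>a' b' c'. quadratic_root a' b' c' (slow_step x) \<and> a' * c' < 0 \<and> b'\<^sup>2 - 4 * a' * c' = b\<^sup>2 - 4 * a * c"
proof -
  have "x \<noteq> 0" "x \<noteq> 1" using assms by auto
  define w where "w = of_int c / x"
  have c: "of_int c = w * x" using \<open>x \<noteq> 0\<close> by (simp add: w_def)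
  have val: "of_int (a + b + c) = (1 - x) * (of_int a - w)"
    using assms \<open>x \<noteq> 0\<close> c by (intro quadratic_value_at_1)
  have neg: "(of_int a * of_int c :: real) < 0"
    using assms(4) by (metis of_int_less_0_iff of_int_mult)
  then have aw: "of_int a * w < 0"
    using assms(3) by (simp add: w_def zero_less_mult_iff mult_less_0_iff divide_less_0_iff zero_less_divide_iff)
  show ?thesis
  proof (cases "x > 1")
    case True
    have "of_int (a * (a + b + c)) = (1 - x) * (of_int a * of_int a - of_int a * w)"
      unfolding of_int_mult val by (simp add: algebra_simps)
    also have "\<dots> < 0"
    proof (intro mult_neg_pos)
      have "(of_int a :: real) * of_int a \<ge> 0" by simp
      then show "of_int a * of_int a - of_int a * w > 0" using aw by linarith
    qed (use True in simp)
    finally have "a * (a + b + c) < 0" by (simp only: of_int_less_0_iff)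
    then show ?thesis
      using quadratic_root_R[OF assms(1)] True
      by (intro exI[of _ a] exI[of _ "b + 2 * a"] exI[of _ "a + b + c"])
        (simp add: slow_step_def power2_eq_square algebra_simps)
  next
    case False
    then have "x < 1" using \<open>x \<noteq> 1\<close> by simp
    have "of_int ((a + b + c) * c) = (1 - x) * (of_int a * of_int c - w * w * x)"
      unfolding of_int_mult val c by (simp add: algebra_simps)
    also have "\<dots> < 0"
    proof (intro mult_pos_neg)
      have "w * w * x \<ge> 0" using assms(3) by simp
      then show "of_int a * of_int c - w * w * x < 0" using neg by linarith
    qed (use \<open>x < 1\<close> in simp)
    finally have "(a + b + c) * c < 0" by (simp only: of_int_less_0_iff)
    then show ?thesis
      using quadratic_root_L[OF assms(1) \<open>x \<noteq> 1\<close>] False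
      by (intro exI[of _ "a + b + c"] exI[of _ "b + 2 * c"] exI[of _ c])
        (simp add: slow_step_def power2_eq_square algebra_simps)
  qed
qed

text \<open>If \<open>a\<close> and \<open>c\<close> have the same sign, then b x = -(a x^2 + c)
  forces the opposite sign on \<open>b\<close>.\<close>

lemma quadratic_root_signs:
  assumes "quadratic_root a b c x" "x > 0" "a * c > 0"
  shows "a * b < 0" "c * b < 0"
proof -
  have pos: "(of_int a * of_int c :: real) > 0"
    using assms(3) by (metis of_int_0_less_iff of_int_mult)
  have eq: "of_int b * x = - (of_int a * x\<^sup>2 + of_int c)"
    using assms(1) by (simp add: quadratic_root_def)
  have nz: "(of_int a)\<^sup>2 * x\<^sup>2 \<ge> (0::real)" "(of_int c)\<^sup>2 \<ge> (0::real)" "(of_int a * of_int c) * x\<^sup>2 \<ge> 0"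
    using pos by simp_all
  have "(of_int a * of_int b) * x = of_int a * (of_int b * x)" by simp
  also have "\<dots> = - ((of_int a)\<^sup>2 * x\<^sup>2 + of_int a * of_int c)"
    unfolding eq by (simp add: power2_eq_square algebra_simps)
  also have "\<dots> < 0" using nz pos by linarith
  finally have "of_int (a * b) < (0 :: real)" using assms(2) by (simp add: mult_less_0_iff)
  then show "a * b < 0" by (simp only: of_int_less_0_iff)
  have "(of_int c * of_int b) * x = of_int c * (of_int b * x)" by simp
  also have "\<dots> = - ((of_int a * of_int c) * x\<^sup>2 + (of_int c)\<^sup>2)"
    unfolding eq by (simp add: power2_eq_square algebra_simps)
  also have "\<dots> < 0"
  proof -
    have "(of_int a * of_int c) * x\<^sup>2 > 0" using pos assms(2) by simp
    then show ?thesis using nz by linarith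
  qed
  finally have "of_int (c * b) < (0 :: real)" using assms(2) by (simp add: mult_less_0_iff)
  then show "c * b < 0" by (simp only: of_int_less_0_iff)
qed

text \<open>Both \<open>b\<close> and \<open>b + 2 * a\<close> lie on the side of 0 opposite to
  \<open>a\<close>, so the step by 2a moves towards 0 without crossing it.\<close>

lemma abs_add_double_less:
  fixes a b :: int
  assumes "a * b < 0" "a * (b + 2 * a) < 0"
  shows "\<bar>b + 2 * a\<bar> < \<bar>b\<bar>"
  using assms by (auto simp: mult_less_0_iff)

text \<open>While both roots stay positive, the middle coefficient shrinks, so the roots eventually separate.\<close>

lemma slow_step_reaches_indefinite:
  assumes "quadratic_root a b c x" "x \<notin> \<rat>" "x > 0" "a \<noteq> 0"
  shows "\<exists>n a' b' c'. quadratic_root a' b' c' ((slow_step ^^ n) x) \<and> a' * c' < 0"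
  using assms
proof (induction "nat \<bar>b\<bar>" arbitrary: a b c x rule: less_induct)
  case less
  have "c \<noteq> 0" using quadratic_root_nonzero less.prems by blast
  have "x \<noteq> 1" using less.prems by auto
  show ?case
  proof (cases "a * c < 0")
    case True
    then show ?thesis using less.prems(1)
      by (intro exI[of _ 0] exI[of _ a] exI[of _ b] exI[of _ c]) simp
  next
    case False
    moreover have "a * c \<noteq> 0" using \<open>c \<noteq> 0\<close> less.prems(4) by simp
    ultimately have "a * c > 0" by linarith
    note signs = quadratic_root_signs[OF less.prems(1,3) this]
    define a' b' c' where "a' = (if x > 1 then a else a + b + c)"
      and "b' = (if x > 1 then b + 2 * a else b + 2 * c)"
      and "c' = (if x > 1 then a + b + c else c)"
    have root: "quadratic_root a' b' c' (slow_step x)"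
      using quadratic_root_R[OF less.prems(1)] quadratic_root_L[OF less.prems(1) \<open>x \<noteq> 1\<close>]
      by (simp add: a'_def b'_def c'_def slow_step_def)
    note step = slow_step_irrational[OF less.prems(2)] slow_step_pos[OF less.prems(2,3)]
    have "a' \<noteq> 0"
    proof
      assume "a' = 0"
      then have "of_int b' * slow_step x + of_int c' = 0"
        using root by (simp add: quadratic_root_def)
      then have "c' = 0" "b' = 0" using linear_rational_root step by blast+
      then show False using \<open>a' = 0\<close> \<open>c \<noteq> 0\<close> less.prems(4) by (auto simp: a'_def b'_def c'_def split: if_splits)
    qed
    then have "c' \<noteq> 0" using quadratic_root_nonzero root step by blast
    show ?thesis
    proof (cases "a' * c' < 0")
      case True
      then show ?thesis using root by (intro exI[of _ 1] exI[of _ a'] exI[of _ b'] exI[of _ c']) auto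
    next
      case False
      moreover have "a' * c' \<noteq> 0" using \<open>c' \<noteq> 0\<close> \<open>a' \<noteq> 0\<close> by simp
      ultimately have "a' * c' > 0" by linarith
      note signs' = quadratic_root_signs[OF root step(2) this]
      \<comment> \<open>The sign conditions hold before and after the step; the branch below 1 is
        the same argument with \<open>c\<close> in the role of \<open>a\<close>.\<close>
      have "\<bar>b'\<bar> < \<bar>b\<bar>"
        using abs_add_double_less[of a b] abs_add_double_less[of c b] signs signs'
        by (cases "x > 1") (simp_all add: a'_def b'_def c'_def)
      then have "nat \<bar>b'\<bar> < nat \<bar>b\<bar>" by simp
      from less.hyps[OF this root step \<open>a' \<noteq> 0\<close>] obtain n a'' b'' c''
        where "quadratic_root a'' b'' c'' ((slow_step ^^ n) (slow_step x))" "a'' * c'' < 0" by blast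
      then show ?thesis
        by (intro exI[of _ "Suc n"] exI[of _ a''] exI[of _ b''] exI[of _ c'']) (simp add: funpow_swap1)
    qed
  qed
qed

section \<open>Finiteness and periodicity of the slow orbit\<close>

lemma finite_quadratic_roots:
  assumes "a \<noteq> 0"
  shows "finite {x. quadratic_root a b c x}"
proof -
  let ?p = "[:of_int c, of_int b, of_int a:] :: real poly"
  have "?p \<noteq> 0" using assms by simp
  then have "finite {x. poly ?p x = 0}" by (rule poly_roots_finite)
  moreover have "{x. quadratic_root a b c x} = {x. poly ?p x = 0}"
    by (auto simp: quadratic_root_def power2_eq_square algebra_simps)
  ultimately show ?thesis by simp
qed

text \<open>When \<open>a * c < 0\<close>, both terms of d = b^2 + 4|ac| are nonnegative, so d
  bounds all three coefficients.\<close>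

lemma finite_indefinite_forms:
  "finite {(a :: int, b :: int, c :: int). a * c < 0 \<and> b\<^sup>2 - 4 * a * c = d}"
proof (rule finite_subset)
  show "{(a :: int, b :: int, c :: int). a * c < 0 \<and> b\<^sup>2 - 4 * a * c = d} \<subseteq> {-d..d} \<times> {-d..d} \<times> {-d..d}"
  proof
    fix t :: "int \<times> int \<times> int"
    assume t: "t \<in> {(a, b, c). a * c < 0 \<and> b\<^sup>2 - 4 * a * c = d}"
    obtain a b c where abc: "t = (a, b, c)" by (cases t)
    have neg: "a * c < 0" and d: "d = b\<^sup>2 - 4 * (a * c)" using t by (auto simp: abc)
    have "\<bar>a\<bar> * 1 \<le> \<bar>a\<bar> * \<bar>c\<bar>" "1 * \<bar>c\<bar> \<le> \<bar>a\<bar> * \<bar>c\<bar>"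
      using neg by (intro mult_mono; auto simp: mult_less_0_iff)+
    moreover have "\<bar>a\<bar> * \<bar>c\<bar> = - (a * c)" using neg by (simp add: abs_mult[symmetric])
    moreover have "\<bar>b\<bar> \<le> b\<^sup>2"
      using self_le_power[of "\<bar>b\<bar>" 2] by (cases "b = 0") auto
    ultimately have "\<bar>a\<bar> \<le> d" "\<bar>b\<bar> \<le> d" "\<bar>c\<bar> \<le> d"
      using neg d zero_le_power2[of b] by linarith+
    then show "t \<in> {-d..d} \<times> {-d..d} \<times> {-d..d}" by (auto simp: abc)
  qed
qed simp

lemma slow_orbit_indefinite:
  assumes "quadratic_root a b c x" "x \<notin> \<rat>" "x > 0" "a * c < 0"
  shows "\<exists>a' b' c'. quadratic_root a' b' c' ((slow_step ^^ n) x) \<and> a' * c' < 0 \<and> b'\<^sup>2 - 4 * a' * c' = b\<^sup>2 - 4 * a * c"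
proof (induction n)
  case 0
  then show ?case using assms by auto
next
  case (Suc n)
  then obtain a' b' c' where "quadratic_root a' b' c' ((slow_step ^^ n) x)" "a' * c' < 0"
    "b'\<^sup>2 - 4 * a' * c' = b\<^sup>2 - 4 * a * c" by blast
  then show ?case
    using slow_step_quadratic_indefinite[OF _ funpow_slow_step[OF assms(2,3)], of a' b' c' n] by simp
qed

lemma finite_slow_orbit:
  assumes "quadratic_root a b c x" "x \<notin> \<rat>" "x > 0" "a \<noteq> 0"
  shows "finite (range (\<lambda>n. (slow_step ^^ n) x))"
proof -
  obtain m a' b' c' where m: "quadratic_root a' b' c' ((slow_step ^^ m) x)" "a' * c' < 0"
    using slow_step_reaches_indefinite[OF assms] by blast
  define d where "d = b'\<^sup>2 - 4 * a' * c'"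
  let ?forms = "{(a :: int, b :: int, c :: int). a * c < 0 \<and> b\<^sup>2 - 4 * a * c = d}"
  let ?roots = "\<Union>(a, b, c)\<in>?forms. {x. quadratic_root a b c x}"
  have "finite ?roots"
    using finite_indefinite_forms by (intro finite_UN_I) (auto intro!: finite_quadratic_roots)
  moreover have "(slow_step ^^ n) ((slow_step ^^ m) x) \<in> ?roots" for n
  proof -
    obtain a b c where "quadratic_root a b c ((slow_step ^^ n) ((slow_step ^^ m) x))"
        "a * c < 0" "b\<^sup>2 - 4 * a * c = d"
      using slow_orbit_indefinite[OF m(1) funpow_slow_step[OF assms(2,3)] m(2), of n] unfolding d_def by blast
    then show ?thesis by (intro UN_I[of "(a, b, c)"]) simp_all
  qed
  then have "range (\<lambda>n. (slow_step ^^ n) ((slow_step ^^ m) x)) \<subseteq> ?roots" by (rule image_subsetI)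
  ultimately have fin: "finite (range (\<lambda>n. (slow_step ^^ n) ((slow_step ^^ m) x)))"
    by (rule finite_subset[rotated])
  have "range (\<lambda>n. (slow_step ^^ n) x) \<subseteq> (\<lambda>n. (slow_step ^^ n) x) ` {..<m} \<union> range (\<lambda>n. (slow_step ^^ n) ((slow_step ^^ m) x))"
  proof (rule image_subsetI)
    fix n
    show "(slow_step ^^ n) x \<in> (\<lambda>n. (slow_step ^^ n) x) ` {..<m} \<union> range (\<lambda>n. (slow_step ^^ n) ((slow_step ^^ m) x))"
    proof (cases "n < m")
      case False
      then have "(slow_step ^^ n) x = (slow_step ^^ (n - m + m)) x" by simp
      also have "\<dots> = (slow_step ^^ (n - m)) ((slow_step ^^ m) x)" by (simp only: funpow_add o_apply)
      finally show ?thesis by (intro UnI2) (rule image_eqI[of _ _ "n - m"], simp_all)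
    qed simp
  qed
  then show ?thesis by (rule finite_subset) (simp add: fin)
qed

lemma slow_orbit_periodic:
  assumes "quadratic_root a b c x" "x \<notin> \<rat>" "x > 0" "a \<noteq> 0"
  obtains m n where "n > 0" "(slow_step ^^ n) ((slow_step ^^ m) x) = (slow_step ^^ m) x"
proof -
  have "\<not> inj (\<lambda>n. (slow_step ^^ n) x)"
    using finite_slow_orbit[OF assms] finite_imageD[of "\<lambda>n. (slow_step ^^ n) x" UNIV] by auto
  then obtain i j where ij: "i < j" "(slow_step ^^ i) x = (slow_step ^^ j) x"
    by (auto simp: inj_def) (metis nat_neq_iff)
  have "(slow_step ^^ (j - i)) ((slow_step ^^ i) x) = (slow_step ^^ (j - i + i)) x"
    by (simp only: funpow_add o_apply)
  then show ?thesis using that[of "j - i" i] ij by simp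
qed

section \<open>Word matrices and their traces\<close>

text \<open>One evaluation homomorphism used at three points: at \<open>fls_X\<close> for
  deformations, at 1 for the classical action, and at \<open>Poly_Mapping.single 1 1\<close> for
  Laurent polynomials.\<close>

definition int_poly_eval :: "'a::comm_ring_1 \<Rightarrow> int poly \<Rightarrow> 'a" where
  "int_poly_eval t P = (\<Sum>i\<le>degree P. of_int (coeff P i) * t ^ i)"

lemma int_poly_eval_altdef: "int_poly_eval t P = poly (map_poly of_int P) t"
proof -
  have "degree (map_poly of_int P :: 'a poly) \<le> degree P"
    by (intro degree_le) (auto simp: coeff_map_poly coeff_eq_0)
  then have "poly (map_poly of_int P) t = (\<Sum>i\<le>degree P. coeff (map_poly of_int P) i * t ^ i)"
    unfolding poly_altdef by (intro sum.mono_neutral_left) (auto simp: coeff_eq_0)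
  then show ?thesis
    by (simp add: int_poly_eval_def coeff_map_poly)
qed

lemma int_poly_eval_0 [simp]: "int_poly_eval t 0 = 0"
  by (simp add: int_poly_eval_altdef)

lemma int_poly_eval_pCons [simp]: "int_poly_eval t (pCons a P) = of_int a + t * int_poly_eval t P"
  by (cases "a = 0 \<and> P = 0") (auto simp: int_poly_eval_altdef map_poly_pCons)

lemma int_poly_eval_1 [simp]: "int_poly_eval t 1 = 1"
  by (simp add: one_pCons)

lemma int_poly_eval_add [simp]: "int_poly_eval t (P + Q) = int_poly_eval t P + int_poly_eval t Q"
  by (induction P Q rule: poly_induct2) (simp_all add: algebra_simps)

lemma int_poly_eval_smult [simp]: "int_poly_eval t (smult a P) = of_int a * int_poly_eval t P"
  by (induction P) (simp_all add: algebra_simps)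

lemma int_poly_eval_uminus [simp]: "int_poly_eval t (- P) = - int_poly_eval t P"
  using int_poly_eval_smult[of t "-1" P] by simp

lemma int_poly_eval_diff [simp]: "int_poly_eval t (P - Q) = int_poly_eval t P - int_poly_eval t Q"
  using int_poly_eval_add[of t P "- Q"] by simp

lemma int_poly_eval_mult [simp]: "int_poly_eval t (P * Q) = int_poly_eval t P * int_poly_eval t Q"
  by (induction P) (simp_all add: algebra_simps)

lemma int_poly_eval_power [simp]: "int_poly_eval t (P ^ n) = int_poly_eval t P ^ n"
  by (induction n) simp_all

lemma int_poly_eval_numeral [simp]: "int_poly_eval t (numeral n) = numeral n"
  by (simp add: numeral_poly)

lemma int_poly_eval_at_1: "int_poly_eval 1 P = of_int (poly P 1)"
  by (induction P) simp_all

lemma single_power: "Poly_Mapping.single 1 1 ^ n = (Poly_Mapping.single (int n) 1 :: int_laurent)"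
  by (induction n) (simp_all add: mult_single)

lemma laurent_of_poly_eval: "laurent_of_poly P = int_poly_eval (Poly_Mapping.single 1 1) P"
proof -
  have "of_int c * Poly_Mapping.single k 1 = (Poly_Mapping.single k c :: int_laurent)" for c k
  proof -
    have "of_int c = (Poly_Mapping.single 0 c :: int_laurent)" 
      using single_of_int[of c, where 'a=int and 'b=int] by simp
    then show ?thesis by (simp add: mult_single)
  qed
  then show ?thesis
    by (simp add: laurent_of_poly_def int_poly_eval_def single_power)
qed

lemma lookup_laurent_of_poly:
  "Poly_Mapping.lookup (laurent_of_poly P) k = (if k < 0 then 0 else coeff P (nat k))"
proof -
  have "Poly_Mapping.lookup (laurent_of_poly P) k = (\<Sum>i\<le>degree P. if int i = k then coeff P i else 0)"
    unfolding laurent_of_poly_def lookup_sum by (intro sum.cong) (auto simp: lookup_single when_def)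
  also have "\<dots> = (if k < 0 then 0 else coeff P (nat k))"
  proof (cases "k < 0")
    case False
    then have "(\<Sum>i\<le>degree P. if int i = k then coeff P i else 0) = (\<Sum>i\<le>degree P. if i = nat k then coeff P i else 0)"
      by (intro sum.cong) auto
    then show ?thesis using False by (simp add: coeff_eq_0)
  qed (auto intro!: sum.neutral)
  finally show ?thesis .
qed

lemma fls_of_laurent_superset:
  assumes "finite S" "Poly_Mapping.keys f \<subseteq> S"
  shows "fls_of_laurent f = (\<Sum>n\<in>S. of_int (Poly_Mapping.lookup f n) * fls_X powi n)"
  unfolding fls_of_laurent_def
  by (rule sum.mono_neutral_left) (use assms in \<open>auto simp: in_keys_iff\<close>)

lemma fls_of_poly_eval: "fls_of_poly P = int_poly_eval fls_X P"
proof -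
  have "Poly_Mapping.keys (laurent_of_poly P) \<subseteq> int ` {..degree P}"
  proof
    fix k assume "k \<in> Poly_Mapping.keys (laurent_of_poly P)"
    then have "k \<ge> 0" "coeff P (nat k) \<noteq> 0"
      by (auto simp: in_keys_iff lookup_laurent_of_poly split: if_splits)
    then show "k \<in> int ` {..degree P}"
      by (intro image_eqI[of _ _ "nat k"]) (auto simp: le_degree)
  qed
  then have "fls_of_poly P = (\<Sum>n\<in>int ` {..degree P}. of_int (Poly_Mapping.lookup (laurent_of_poly P) n) * fls_X powi n)"
    unfolding fls_of_poly_def by (intro fls_of_laurent_superset) auto
  also have "\<dots> = (\<Sum>i\<le>degree P. of_int (coeff P i) * fls_X powi int i)"
    by (subst sum.reindex) (auto simp: lookup_laurent_of_poly simp del: fls_X_power_int)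
  finally show ?thesis by (simp only: int_poly_eval_def power_int_of_nat)
qed

lemma lookup_single_mult:
  "Poly_Mapping.lookup (Poly_Mapping.single N 1 * f) k = Poly_Mapping.lookup f (k - N)"
  for f :: int_laurent
proof -
  have "k = N + q \<longleftrightarrow> q = k - N" for q by auto
  moreover have "Poly_Mapping.lookup (Poly_Mapping.single N 1 * f) k =
      Sum_any (\<lambda>l. Sum_any (\<lambda>q. Poly_Mapping.lookup f q when k = l + q) when l = N)"
    unfolding lookup_mult by (intro Sum_any.cong) (simp add: lookup_single when_def)
  ultimately show ?thesis by simp
qed

section \<open>Palindromes and reflection of polynomials\<close>

lemma palindrome_iff:
  "palindrome f \<longleftrightarrow> (\<exists>N. \<forall>k. Poly_Mapping.lookup f k = Poly_Mapping.lookup f (N - k))"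
proof -
  have "inj (uminus :: int \<Rightarrow> int)" by (simp add: inj_def)
  then have "Poly_Mapping.lookup (Poly_Mapping.single N 1 * Poly_Mapping.map_key uminus f) k =
      Poly_Mapping.lookup f (N - k)" for N k
    by (simp add: lookup_single_mult map_key.rep_eq)
  then show ?thesis
    by (simp add: palindrome_def poly_mapping_eq_iff fun_eq_iff)
qed

abbreviation qvar :: "int poly" where
  "qvar \<equiv> [:0, 1:]"

lemma palindrome_qvar_mult:
  assumes "palindrome (laurent_of_poly P)"
  shows "palindrome (laurent_of_poly (qvar * P))"
proof -
  have eq: "laurent_of_poly (qvar * P) = Poly_Mapping.single 1 1 * laurent_of_poly P"
    by (simp add: laurent_of_poly_eval)
  obtain N where "Poly_Mapping.lookup (laurent_of_poly P) k = Poly_Mapping.lookup (laurent_of_poly P) (N - k)" for k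
    using assms unfolding palindrome_iff by blast
  from this[of "k - 1" for k]
  show ?thesis unfolding palindrome_iff eq lookup_single_mult
    \<comment> \<open>The centre of symmetry N/2 moves up by one.\<close>
    by (intro exI[of _ "N + 2"]) (simp add: algebra_simps)
qed

text \<open>This is q^n P(1/q) when the degree is at most \<open>n\<close>. The level is prescribed,
  unlike in \<open>reflect_poly\<close>, so that reflection is additive and all entries of a matrix
  are reflected at the same level.\<close>

definition refl_poly :: "nat \<Rightarrow> int poly \<Rightarrow> int poly" where
  "refl_poly n P = (\<Sum>i\<le>n. monom (coeff P (n - i)) i)"

lemma coeff_refl_poly: "coeff (refl_poly n P) i = (if i \<le> n then coeff P (n - i) else 0)"
  by (simp add: refl_poly_def coeff_sum)

lemma refl_poly_add: "refl_poly n (P + Q) = refl_poly n P + refl_poly n Q"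
  by (rule poly_eqI) (simp add: coeff_refl_poly)

lemma coeff_qvar_mult: "coeff (qvar * P) i = (case i of 0 \<Rightarrow> 0 | Suc j \<Rightarrow> coeff P j)"
  by (simp add: coeff_pCons)

lemma refl_poly_Suc: "degree P \<le> n \<Longrightarrow> refl_poly (Suc n) P = qvar * refl_poly n P"
  by (rule poly_eqI)
    (auto simp: coeff_refl_poly coeff_qvar_mult coeff_eq_0 split: nat.splits simp del: mult_pCons_left)

lemma refl_poly_Suc_qvar_mult: "refl_poly (Suc n) (qvar * P) = refl_poly n P"
  by (rule poly_eqI)
    (auto simp: coeff_refl_poly coeff_qvar_mult Suc_diff_le split: nat.splits simp del: mult_pCons_left)

text \<open>The entries of the products of \<open>n\<close> factors, each \<open>R = (q, 1; 0, 1)\<close> or \<open>L = (q, 0; q, 1)\<close>.\<close>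

inductive word_matrix :: "nat \<Rightarrow> int poly \<Rightarrow> int poly \<Rightarrow> int poly \<Rightarrow> int poly \<Rightarrow> bool" where
  word_matrix_0: "word_matrix 0 1 0 0 1"
| word_matrix_R: "word_matrix n A B C D \<Longrightarrow> word_matrix (Suc n) (qvar * A + C) (qvar * B + D) C D"
| word_matrix_L: "word_matrix n A B C D \<Longrightarrow> word_matrix (Suc n) (qvar * A) (qvar * B) (qvar * A + C) (qvar * B + D)"

lemma word_matrix_det: "word_matrix n A B C D \<Longrightarrow> A * D - B * C = qvar ^ n"
proof (induction rule: word_matrix.induct)
  case (word_matrix_R n A B C D)
  define q where "q = qvar"
  have "(q * A + C) * D - (q * B + D) * C = q * (A * D - B * C)"
    by (simp add: algebra_simps)
  then show ?case using word_matrix_R by (simp only: q_def power_Suc)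
next
  case (word_matrix_L n A B C D)
  define q where "q = qvar"
  have "q * A * (q * B + D) - q * B * (q * A + C) = q * (A * D - B * C)"
    by (simp add: algebra_simps)
  then show ?case using word_matrix_L by (simp only: q_def power_Suc)
qed simp

lemma word_matrix_degree:
  "word_matrix n A B C D \<Longrightarrow> degree A \<le> n \<and> degree B \<le> n \<and> degree C \<le> n \<and> degree D \<le> n"
proof (induction rule: word_matrix.induct)
  case (word_matrix_R n A B C D)
  then show ?case by (auto intro!: degree_add_le simp: degree_pCons_le intro: order_trans[OF degree_pCons_le])
next
  case (word_matrix_L n A B C D)
  then show ?case by (auto intro!: degree_add_le simp: degree_pCons_le intro: order_trans[OF degree_pCons_le])
qed simp

text \<open>At q = 0 both letters have first column 0 and second row (0, 1). For nonempty words the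
  trace thus has constant term 1.\<close>

lemma word_matrix_nth_0:
  "word_matrix n A B C D \<Longrightarrow> coeff C 0 = 0 \<and> coeff D 0 = 1 \<and> (n > 0 \<longrightarrow> coeff A 0 = 0)"
  by (induction rule: word_matrix.induct) auto

text \<open>At q = 1 each letter adds one row to the other. Rows stay nonnegative and nonzero, so
  the entry sum grows by at least 1 per letter; this later excludes the identity matrix.\<close>

lemma word_matrix_at_1:
  "word_matrix n A B C D \<Longrightarrow>
    poly A 1 \<ge> 0 \<and> poly B 1 \<ge> 0 \<and> poly C 1 \<ge> 0 \<and> poly D 1 \<ge> 0 \<and> poly A 1 + poly B 1 \<ge> 1 \<and> poly C 1 + poly D 1 \<ge> 1 \<and>
    poly A 1 + poly B 1 + poly C 1 + poly D 1 \<ge> int n + 2"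
  by (induction rule: word_matrix.induct) auto

text \<open>Left multiplication by a letter combines the two rows of inductive equations with
  coefficients 1 and q; this rule assembles such a combination.\<close>

lemma lin_comb: "a = b \<Longrightarrow> c = d \<Longrightarrow> l = a + q * c \<Longrightarrow> r = b + q * d \<Longrightarrow> l = r"
  for q :: "'a::comm_ring"
  by simp

text \<open>
  Both \<open>R\<close> and \<open>L\<close> are intertwined with \<open>q R(1/q)\<close> and \<open>q L(1/q)\<close> by the single matrix
  \<open>K = (q, 1 - q; q - 1, 1)\<close>, so every word \<open>W\<close> satisfies \<open>K W = q\<^sup>n W(1/q) K\<close>.
\<close>

lemma word_matrix_intertwine:
  assumes q: "q = qvar" and "word_matrix n A B C D"
  shows "q * A + (1 - q) * C = refl_poly n A * q + refl_poly n B * (q - 1) \<and>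
    q * B + (1 - q) * D = refl_poly n A * (1 - q) + refl_poly n B \<and>
    (q - 1) * A + C = refl_poly n C * q + refl_poly n D * (q - 1) \<and>
    (q - 1) * B + D = refl_poly n C * (1 - q) + refl_poly n D"
  using assms(2)
proof (induction rule: word_matrix.induct)
  case word_matrix_0
  have "refl_poly 0 1 = 1" "refl_poly 0 0 = 0"
    by (simp_all add: refl_poly_def)
  then show ?case by (simp add: algebra_simps)
next
  case (word_matrix_R n A B C D)
  \<comment> \<open>Reflection at level n + 1 turns the letter R into q R(1/q) = (1, q; 0,
    q).\<close>
  have *: "refl_poly (Suc n) (q * A + C) = refl_poly n A + q * refl_poly n C"
    "refl_poly (Suc n) (q * B + D) = refl_poly n B + q * refl_poly n D"
    "refl_poly (Suc n) C = q * refl_poly n C" "refl_poly (Suc n) D = q * refl_poly n D"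
    using word_matrix_degree[OF word_matrix_R(1)] unfolding q
    by (simp_all only: refl_poly_add refl_poly_Suc refl_poly_Suc_qvar_mult)
  note IH = word_matrix_R(2)[THEN conjunct1] word_matrix_R(2)[THEN conjunct2, THEN conjunct1]
    word_matrix_R(2)[THEN conjunct2, THEN conjunct2, THEN conjunct1]
    word_matrix_R(2)[THEN conjunct2, THEN conjunct2, THEN conjunct2]
  show ?case
    unfolding q[symmetric] *
  proof (intro conjI)
    show "q * (q * A + C) + (1 - q) * C =
        (refl_poly n A + q * refl_poly n C) * q + (refl_poly n B + q * refl_poly n D) * (q - 1)"
      by (rule lin_comb[OF IH(1,3), of _ q]) (simp_all add: algebra_simps)
    show "q * (q * B + D) + (1 - q) * D =
        (refl_poly n A + q * refl_poly n C) * (1 - q) + (refl_poly n B + q * refl_poly n D)"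
      by (rule lin_comb[OF IH(2,4), of _ q]) (simp_all add: algebra_simps)
    show "(q - 1) * (q * A + C) + C = q * refl_poly n C * q + q * refl_poly n D * (q - 1)"
      \<comment> \<open>The equation 0 = 0 fills the slot of a row that does not contribute.\<close>
      by (rule lin_comb[OF refl[of 0] IH(3), of _ q]) (simp_all add: algebra_simps)
    show "(q - 1) * (q * B + D) + D = q * refl_poly n C * (1 - q) + q * refl_poly n D"
      by (rule lin_comb[OF refl[of 0] IH(4), of _ q]) (simp_all add: algebra_simps)
  qed
next
  case (word_matrix_L n A B C D)
  have *: "refl_poly (Suc n) (q * A) = refl_poly n A" "refl_poly (Suc n) (q * B) = refl_poly n B"
    "refl_poly (Suc n) (q * A + C) = refl_poly n A + q * refl_poly n C"
    "refl_poly (Suc n) (q * B + D) = refl_poly n B + q * refl_poly n D"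
    using word_matrix_degree[OF word_matrix_L(1)] unfolding q
    by (simp_all only: refl_poly_add refl_poly_Suc refl_poly_Suc_qvar_mult)
  note IH = word_matrix_L(2)[THEN conjunct1] word_matrix_L(2)[THEN conjunct2, THEN conjunct1]
    word_matrix_L(2)[THEN conjunct2, THEN conjunct2, THEN conjunct1]
    word_matrix_L(2)[THEN conjunct2, THEN conjunct2, THEN conjunct2]
  show ?case
    unfolding q[symmetric] *
  proof (intro conjI)
    show "q * (q * A) + (1 - q) * (q * A + C) = refl_poly n A * q + refl_poly n B * (q - 1)"
      by (rule lin_comb[OF IH(1) refl[of 0], of _ q]) (simp_all add: algebra_simps)
    show "q * (q * B) + (1 - q) * (q * B + D) = refl_poly n A * (1 - q) + refl_poly n B"
      by (rule lin_comb[OF IH(2) refl[of 0], of _ q]) (simp_all add: algebra_simps)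
    show "(q - 1) * (q * A) + (q * A + C) =
        (refl_poly n A + q * refl_poly n C) * q + (refl_poly n B + q * refl_poly n D) * (q - 1)"
      by (rule lin_comb[OF IH(1,3), of _ q]) (simp_all add: algebra_simps)
    show "(q - 1) * (q * B) + (q * B + D) =
        (refl_poly n A + q * refl_poly n C) * (1 - q) + (refl_poly n B + q * refl_poly n D)"
      by (rule lin_comb[OF IH(2,4), of _ q]) (simp_all add: algebra_simps)
  qed
qed

text \<open>Let W' = q^n W(1/q), so that K W = W' K. Multiplying by adj K and taking traces gives
  det K tr W = det K tr W', and det K = q^2 - q + 1 can be cancelled in a domain.\<close>

lemma word_matrix_trace_refl:
  assumes "word_matrix n A B C D"
  shows "refl_poly n (A + D) = A + D"
proof -
  define q A' B' C' D' where defs: "q = qvar" "A' = refl_poly n A" "B' = refl_poly n B" "C' = refl_poly n C" "D' = refl_poly n D"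
  note eqs = word_matrix_intertwine[OF defs(1) assms, folded defs(2-)]
  \<comment> \<open>The trace of adj(K) (K W), with adj K = (1, q - 1; 1 - q, q); the next step
    substitutes W' K for K W.\<close>
  have "(q\<^sup>2 - q + 1) * (A + D) = (q * A + (1 - q) * C) + (1 - q) * (q * B + (1 - q) * D)
      + (q - 1) * ((q - 1) * A + C) + q * ((q - 1) * B + D)"
    by (simp add: power2_eq_square algebra_simps)
  also have "\<dots> = (A' * q + B' * (q - 1)) + (1 - q) * (A' * (1 - q) + B')
      + (q - 1) * (C' * q + D' * (q - 1)) + q * (C' * (1 - q) + D')"
    using eqs by (simp only:)
  also have "\<dots> = (q\<^sup>2 - q + 1) * (A' + D')"
    by (simp add: power2_eq_square algebra_simps)
  finally have "(q\<^sup>2 - q + 1) * (A' + D') = (q\<^sup>2 - q + 1) * (A + D)" by (rule sym)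
  moreover have "poly (q\<^sup>2 - q + 1) 0 \<noteq> 0" by (simp add: defs)
  then have "q\<^sup>2 - q + 1 \<noteq> 0" by (metis poly_0)
  ultimately show ?thesis by (simp add: refl_poly_add defs)
qed

text \<open>The constant term 1 reflects to the coefficient at \<open>n\<close>, so the trace has
  degree exactly \<open>n\<close> and is its own \<open>reflect_poly\<close>. Its square is
  symmetric about q^n, precisely where the term 4 q^n sits.\<close>

lemma word_matrix_discriminant_palindrome:
  assumes "word_matrix n A B C D" "n > 0"
  shows "palindrome (laurent_of_poly ((A + D)\<^sup>2 - 4 * qvar ^ n))"
proof -
  define t where "t = A + D"
  have refl: "refl_poly n t = t" using word_matrix_trace_refl[OF assms(1)] by (simp add: t_def)
  have "degree t \<le> n" using word_matrix_degree[OF assms(1)] by (simp add: t_def degree_add_le)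
  have t0: "coeff t 0 = 1" using word_matrix_nth_0[OF assms(1)] assms(2) by (simp add: t_def)
  have "coeff t n = 1" using arg_cong[OF refl, of "\<lambda>p. coeff p n"] t0 by (simp add: coeff_refl_poly)
  then have deg: "degree t = n" using \<open>degree t \<le> n\<close> by (intro antisym le_degree) auto
  have "reflect_poly t = t"
  proof (rule poly_eqI)
    fix i
    show "coeff (reflect_poly t) i = coeff t i"
      using arg_cong[OF refl, of "\<lambda>p. coeff p i"] by (auto simp: coeff_reflect_poly coeff_refl_poly deg)
  qed
  then have refl2: "reflect_poly (t\<^sup>2) = t\<^sup>2" by (simp add: reflect_poly_power)
  have deg2: "degree (t\<^sup>2) = 2 * n" using deg t0 by (subst degree_power_eq) auto
  have sym: "coeff (t\<^sup>2) i = coeff (t\<^sup>2) (2 * n - i)" if "i \<le> 2 * n" for i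
  proof -
    have "coeff (t\<^sup>2) i = coeff (reflect_poly (t\<^sup>2)) i" by (simp only: refl2)
    also have "\<dots> = coeff (t\<^sup>2) (2 * n - i)" using that by (simp only: coeff_reflect_poly deg2) simp
    finally show ?thesis .
  qed
  have mon: "4 * qvar ^ n = monom 4 n"
    by (simp only: monom_altdef numeral_poly mult_pCons_left mult_zero_left pCons_0_0 add_0_right)
  show ?thesis
    unfolding palindrome_iff t_def[symmetric] mon
  proof (intro exI[of _ "2 * int n"] allI)
    fix k
    let ?P = "t\<^sup>2 - monom 4 n"
    have high: "coeff ?P i = 0" if "i > 2 * n" for i
      using that by (simp only: coeff_diff) (simp add: coeff_eq_0 deg2)
    show "Poly_Mapping.lookup (laurent_of_poly ?P) k = Poly_Mapping.lookup (laurent_of_poly ?P) (2 * int n - k)"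
    proof (cases "0 \<le> k \<and> k \<le> 2 * int n")
      case True
      then obtain i where i: "k = int i" "i \<le> 2 * n"
        using that[of "nat k"] by auto
      have ki: "2 * int n - k = int (2 * n - i)" using i by (simp add: of_nat_diff)
      have "coeff (monom 4 n) i = (coeff (monom 4 n) (2 * n - i) :: int)" using i(2) by auto
      then have "coeff ?P i = coeff ?P (2 * n - i)"
        by (simp only: coeff_diff sym[OF i(2), symmetric])
      then show ?thesis
        unfolding ki unfolding i(1) lookup_laurent_of_poly by simp
    next
      case False
      then consider "k < 0" | "k > 2 * int n" by linarith
      then show ?thesis
      proof cases
        case 1
        then have "nat (2 * int n - k) > 2 * n" by linarith
        from high[OF this] show ?thesis using 1 unfolding lookup_laurent_of_poly by simp
      next
        case 2
        then have "nat k > 2 * n" by linarith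
        from high[OF this] show ?thesis using 2 unfolding lookup_laurent_of_poly by simp
      qed
    qed
  qed
qed

section \<open>Fixed points of word matrices\<close>

text \<open>X = (A Y + B)/(C Y + D) with the denominator cleared, so that composing with letters
  requires no proof that C Y + D is nonzero.\<close>

definition mobius_rel :: "'a::comm_ring_1 \<Rightarrow> int poly \<Rightarrow> int poly \<Rightarrow> int poly \<Rightarrow> int poly \<Rightarrow> 'a \<Rightarrow> 'a \<Rightarrow> bool" where
  "mobius_rel t A B C D X Y \<longleftrightarrow>
    X * (int_poly_eval t C * Y + int_poly_eval t D) = int_poly_eval t A * Y + int_poly_eval t B"

lemma mobius_rel_R:
  assumes "mobius_rel t A B C D X Y"
  shows "mobius_rel t (qvar * A + C) (qvar * B + D) C D (t * X + 1) Y"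
proof -
  define a b c d where "a = int_poly_eval t A" and "b = int_poly_eval t B" and "c = int_poly_eval t C" and "d = int_poly_eval t D"
  have "X * (c * Y + d) = a * Y + b"
    using assms by (simp only: mobius_rel_def a_def b_def c_def d_def)
  from arg_cong[OF this, of "\<lambda>u. t * u + c * Y + d"]
  show ?thesis
    by (simp add: mobius_rel_def a_def[symmetric] b_def[symmetric] c_def[symmetric] d_def[symmetric] algebra_simps)
qed

lemma mobius_rel_L:
  fixes X :: "'a::field"
  assumes "mobius_rel t A B C D X Y" "t * X + 1 \<noteq> 0"
  shows "mobius_rel t (qvar * A) (qvar * B) (qvar * A + C) (qvar * B + D) (t * X / (t * X + 1)) Y"
proof -
  define a b c d where "a = int_poly_eval t A" and "b = int_poly_eval t B" and "c = int_poly_eval t C" and "d = int_poly_eval t D"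
  have *: "X * (c * Y + d) = a * Y + b"
    using assms by (simp only: mobius_rel_def a_def b_def c_def d_def)
  have "(t * a + c) * Y + (t * b + d) = t * (a * Y + b) + (c * Y + d)"
    by (simp add: algebra_simps)
  also have "\<dots> = (t * X + 1) * (c * Y + d)"
    unfolding *[symmetric] by (simp add: algebra_simps)
  finally have "t * X / (t * X + 1) * ((t * a + c) * Y + (t * b + d)) = t * (X * (c * Y + d))"
    using assms(2) by simp
  also have "\<dots> = t * a * Y + t * b"
    unfolding * by (simp add: algebra_simps)
  finally show ?thesis
    by (simp add: mobius_rel_def a_def b_def c_def d_def)
qed

lemma q_irrat_slow_step_gt:
  "x \<notin> \<rat> \<Longrightarrow> x > 1 \<Longrightarrow> q_irrat x = fls_X * q_irrat (slow_step x) + 1"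
  using q_irrat_R[of x] by (simp add: slow_step_def q_R_def)

lemma q_irrat_slow_step_less:
  assumes "x \<notin> \<rat>" "0 < x" "x < 1"
  shows "q_irrat x = fls_X * q_irrat (slow_step x) / (fls_X * q_irrat (slow_step x) + 1)"
    "fls_X * q_irrat (slow_step x) + 1 \<noteq> 0"
proof -
  have s: "slow_step x = x / (1 - x)" using assms by (simp add: slow_step_def)
  show "q_irrat x = fls_X * q_irrat (slow_step x) / (fls_X * q_irrat (slow_step x) + 1)"
    using q_irrat_L[OF assms] unfolding s q_L_def .
  show "fls_X * q_irrat (slow_step x) + 1 \<noteq> 0"
    using q_R_nonzero[OF q_irrat_ge_0[OF slow_step_irrational slow_step_pos]] assms
    by (simp add: q_R_def)
qed

text \<open>The factors \<open>1 *\<close> make these facts match \<open>mobius_rel_R\<close> and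
  \<open>mobius_rel_L\<close> at t = 1.\<close>

lemma slow_step_inverse:
  assumes "x > 0" "x \<noteq> 1"
  shows "x > 1 \<Longrightarrow> x = 1 * slow_step x + 1"
    "x < 1 \<Longrightarrow> x = 1 * slow_step x / (1 * slow_step x + 1)"
    "x < 1 \<Longrightarrow> 1 * slow_step x + 1 \<noteq> 0"
  using assms by (auto simp: slow_step_def field_simps)

text \<open>The same word serves at \<open>fls_X\<close> and at 1, since the order relation between
  \<open>x\<close> and 1 selects the letter for both.\<close>

lemma word_matrix_exists:
  assumes "x \<notin> \<rat>" "x > 0"
  shows "\<exists>A B C D. word_matrix n A B C D \<and>
    mobius_rel fls_X A B C D (q_irrat x) (q_irrat ((slow_step ^^ n) x)) \<and>
    mobius_rel 1 A B C D x ((slow_step ^^ n) x)"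
  using assms
proof (induction n arbitrary: x)
  case 0
  then show ?case
    by (intro exI[of _ 1] exI[of _ 0]) (auto simp: word_matrix_0 mobius_rel_def)
next
  case (Suc n)
  have "x \<noteq> 1" using Suc.prems by auto
  obtain A B C D where W: "word_matrix n A B C D"
      "mobius_rel fls_X A B C D (q_irrat (slow_step x)) (q_irrat ((slow_step ^^ Suc n) x))"
      "mobius_rel 1 A B C D (slow_step x) ((slow_step ^^ Suc n) x)"
    using Suc.IH[OF slow_step_irrational[OF Suc.prems(1)] slow_step_pos[OF Suc.prems]]
    by (auto simp: funpow_swap1)
  consider "x > 1" | "x < 1" using \<open>x \<noteq> 1\<close> by linarith
  then show ?case
  proof cases
    case 1
    show ?thesis
      using word_matrix_R[OF W(1)] mobius_rel_R[OF W(2)] mobius_rel_R[OF W(3)]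
        q_irrat_slow_step_gt[OF Suc.prems(1) 1] slow_step_inverse(1)[OF Suc.prems(2) \<open>x \<noteq> 1\<close> 1]
      by metis
  next
    case 2
    note q = q_irrat_slow_step_less[OF Suc.prems 2]
    note s = slow_step_inverse(2,3)[OF Suc.prems(2) \<open>x \<noteq> 1\<close> 2]
    show ?thesis
      using word_matrix_L[OF W(1)] mobius_rel_L[OF W(2) q(2), folded q(1)] mobius_rel_L[OF W(3) s(2), folded s(1)]
      by blast
  qed
qed

text \<open>The properties of a periodic word that survive conjugation along the preperiod, where
  matrices stop being words. The relation at 1 and \<open>poly C 1 \<noteq> 0\<close> are kept
  together because the former is needed to preserve the latter under conjugation by L.\<close>

definition q_fixed :: "real \<Rightarrow> bool" where
  "q_fixed x \<longleftrightarrow> (\<exists>A B C D n.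
    mobius_rel fls_X A B C D (q_irrat x) (q_irrat x) \<and> mobius_rel 1 A B C D x x \<and>
    A * D - B * C = qvar ^ n \<and> palindrome (laurent_of_poly ((A + D)\<^sup>2 - 4 * qvar ^ n)) \<and> poly C 1 \<noteq> 0)"

lemma q_fixed_periodic:
  assumes "x \<notin> \<rat>" "x > 0" "n > 0" "(slow_step ^^ n) x = x"
  shows "q_fixed x"
proof -
  obtain A B C D where W: "word_matrix n A B C D"
      "mobius_rel fls_X A B C D (q_irrat x) (q_irrat x)" "mobius_rel 1 A B C D x x"
    using word_matrix_exists[OF assms(1,2), of n] assms(4) by auto
  \<comment> \<open>If C(1) = 0, determinant 1 and nonnegativity give A(1) = D(1) = 1, and the fixed
    point relation then gives B(1) = 0. This is the identity, with entry sum 2 < n + 2.\<close>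
  have "poly C 1 \<noteq> 0"
  proof
    assume C: "poly C 1 = 0"
    have "poly A 1 * poly D 1 = 1"
      using arg_cong[OF word_matrix_det[OF W(1)], of "\<lambda>P. poly P 1"] C by simp
    then have AD: "poly A 1 = 1" "poly D 1 = 1"
      using word_matrix_at_1[OF W(1)] by (auto simp: zmult_eq_1_iff)
    then have "poly B 1 = 0"
      using W(3) C by (simp add: mobius_rel_def int_poly_eval_at_1)
    then show False using word_matrix_at_1[OF W(1)] AD C assms(3) by simp
  qed
  then show ?thesis
    unfolding q_fixed_def using W word_matrix_det[OF W(1)]
      word_matrix_discriminant_palindrome[OF W(1) assms(3)] by blast
qed

text \<open>Conjugating with an adjugate multiplies the true conjugate by q: the trace gains q,
  while the determinant and the discriminant gain q^2.\<close>

lemma discriminant_scale: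
  assumes "A' + D' = qvar * (A + D)" "palindrome (laurent_of_poly ((A + D)\<^sup>2 - 4 * qvar ^ n))"
  shows "palindrome (laurent_of_poly ((A' + D')\<^sup>2 - 4 * qvar ^ (n + 2)))"
proof -
  define q where "q = qvar"
  have "(q * (A + D))\<^sup>2 - 4 * q ^ (n + 2) = q * (q * ((A + D)\<^sup>2 - 4 * q ^ n))"
    by (simp add: power2_eq_square algebra_simps)
  then have "(A' + D')\<^sup>2 - 4 * qvar ^ (n + 2) = qvar * (qvar * ((A + D)\<^sup>2 - 4 * qvar ^ n))"
    unfolding assms(1) q_def .
  then show ?thesis
    using palindrome_qvar_mult[OF palindrome_qvar_mult[OF assms(2)]] by (simp only:)
qed

section \<open>Transport of fixed points along the branches\<close>

lemma q_fixed_conjugate: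
  assumes "mobius_rel fls_X A' B' C' D' (q_irrat y) (q_irrat y)" "mobius_rel 1 A' B' C' D' y y"
    "A' + D' = qvar * (A + D)" "A' * D' - B' * C' = qvar * (qvar * (A * D - B * C))" "poly C' 1 \<noteq> 0"
    "A * D - B * C = qvar ^ n" "palindrome (laurent_of_poly ((A + D)\<^sup>2 - 4 * qvar ^ n))"
  shows "q_fixed y"
proof -
  have "A' * D' - B' * C' = qvar ^ (n + 2)"
    unfolding assms(4,6) by (simp only: power_add power2_eq_square mult.assoc mult.commute mult.left_commute)
  then show ?thesis
    unfolding q_fixed_def using assms(1,2,5) discriminant_scale[OF assms(3,7)] by blast
qed

text \<open>The matrices in the next three lemmas are the conjugates \<open>R M adj R\<close>, \<open>adj R M R\<close> and \<open>L M adj L\<close>.\<close>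

lemma mobius_rel_conj_R:
  assumes "mobius_rel t A B C D X X" "Y = t * X + 1"
  shows "mobius_rel t (qvar * A + C) (qvar * qvar * B + qvar * D - qvar * A - C) C (qvar * D - C) Y Y"
proof -
  define a b c d where "a = int_poly_eval t A" and "b = int_poly_eval t B" and "c = int_poly_eval t C" and "d = int_poly_eval t D"
  have *: "X * (c * X + d) = a * X + b"
    using assms by (simp only: mobius_rel_def a_def b_def c_def d_def)
  have "Y * (c * Y + (t * d - c)) = t * (t * (X * (c * X + d))) + t * (c * X + d)"
    unfolding assms(2) by (simp add: algebra_simps)
  also have "\<dots> = (t * a + c) * Y + (t * t * b + t * d - t * a - c)"
    unfolding * assms(2) by (simp add: algebra_simps)
  finally show ?thesis
    by (simp add: mobius_rel_def a_def b_def c_def d_def algebra_simps)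
qed

lemma mobius_rel_conj_inverse_R:
  fixes t :: "'a::idom"
  assumes "mobius_rel t A B C D X X" "X = t * Y + 1" "t \<noteq> 0"
  shows "mobius_rel t (qvar * (A - C)) (A - C + B - D) (qvar * qvar * C) (qvar * C + qvar * D) Y Y"
proof -
  define a b c d where "a = int_poly_eval t A" and "b = int_poly_eval t B" and "c = int_poly_eval t C" and "d = int_poly_eval t D"
  have *: "X * (c * X + d) = a * X + b"
    using assms by (simp only: mobius_rel_def a_def b_def c_def d_def)
  have "Y * (t * t * c * Y + (t * c + t * d)) = X * (c * X + d) - (c * X + d)"
    unfolding assms(2) by (simp add: algebra_simps)
  also have "\<dots> = t * (a - c) * Y + (a - c + b - d)"
    unfolding * unfolding assms(2) by (simp add: algebra_simps)
  finally show ?thesis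
    by (simp add: mobius_rel_def a_def b_def c_def d_def algebra_simps)
qed

lemma mobius_rel_conj_L:
  fixes t :: "'a::field"
  assumes "mobius_rel t A B C D X X" "Y = t * X / (t * X + 1)" "t * X + 1 \<noteq> 0"
  shows "mobius_rel t (qvar * A - qvar * qvar * B) (qvar * qvar * B)
    (qvar * A + C - qvar * qvar * B - qvar * D) (qvar * qvar * B + qvar * D) Y Y"
proof -
  define a b c d where "a = int_poly_eval t A" and "b = int_poly_eval t B" and "c = int_poly_eval t C" and "d = int_poly_eval t D"
  have *: "X * (c * X + d) = a * X + b"
    using assms by (simp only: mobius_rel_def a_def b_def c_def d_def)
  define w where "w = t * X + 1"
  have w: "w \<noteq> 0" "Y * w = t * X" using assms(2,3) by (simp_all add: w_def)
  let ?A = "t * a - t * t * b" and ?B = "t * t * b"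
    and ?C = "t * a + c - t * t * b - t * d" and ?D = "t * t * b + t * d"
  \<comment> \<open>\<open>Y\<close> is accessible through \<open>Y * w = t * X\<close>, so
    numerator and denominator of its image are both multiplied by \<open>w\<close>, which is
    cancelled at the end.\<close>
  have num: "(?A * Y + ?B) * w = t * t * (a * X + b)"
  proof -
    have "(?A * Y + ?B) * w = ?A * (Y * w) + ?B * w" by (simp add: algebra_simps)
    also have "\<dots> = t * t * (a * X + b)" unfolding w(2) unfolding w_def by (simp add: algebra_simps)
    finally show ?thesis .
  qed
  have den: "(?C * Y + ?D) * w = t * (w * (c * X + d))"
  proof -
    have "(?C * Y + ?D) * w = ?C * (Y * w) + ?D * w" by (simp add: algebra_simps)
    also have "\<dots> = t * (t * (a * X + b) + (c * X + d))" unfolding w(2) unfolding w_def by (simp add: algebra_simps)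
    also have "\<dots> = t * (w * (c * X + d))" unfolding *[symmetric] unfolding w_def by (simp add: algebra_simps)
    finally show ?thesis .
  qed
  have "Y * (?C * Y + ?D) * w = Y * (t * (w * (c * X + d)))"
    unfolding den[symmetric] by (simp only: mult.assoc)
  also have "\<dots> = t * (Y * w) * (c * X + d)" by (simp only: mult_ac)
  also have "\<dots> = t * t * (X * (c * X + d))" unfolding w(2) by (simp only: mult_ac)
  also have "\<dots> = (?A * Y + ?B) * w" unfolding * num ..
  finally have "Y * (?C * Y + ?D) = ?A * Y + ?B" using w(1) by simp
  then show ?thesis
    by (simp add: mobius_rel_def a_def b_def c_def d_def algebra_simps)
qed

lemma q_fixed_R:
  assumes "q_fixed (x - 1)" "x \<notin> \<rat>"
  shows "q_fixed x"
proof -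
  define q where "q = qvar"
  obtain A B C D n where M: "mobius_rel fls_X A B C D (q_irrat (x - 1)) (q_irrat (x - 1))"
      "mobius_rel 1 A B C D (x - 1) (x - 1)" "A * D - B * C = qvar ^ n"
      "palindrome (laurent_of_poly ((A + D)\<^sup>2 - 4 * qvar ^ n))" "poly C 1 \<noteq> 0"
    using assms(1) unfolding q_fixed_def by blast
  have "q_irrat x = fls_X * q_irrat (x - 1) + 1"
    using q_irrat_R[OF assms(2)] by (simp add: q_R_def)
  note q = mobius_rel_conj_R[OF M(1) this]
  have r: "mobius_rel 1 (qvar * A + C) (qvar * qvar * B + qvar * D - qvar * A - C) C (qvar * D - C) x x"
    by (rule mobius_rel_conj_R[OF M(2)]) simp
  have "q * A + C + (q * D - C) = q * (A + D)"
    "(q * A + C) * (q * D - C) - (q * q * B + q * D - q * A - C) * C = q * (q * (A * D - B * C))"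
    by (simp_all add: algebra_simps)
  from q_fixed_conjugate[OF q r this[unfolded q_def] M(5,3,4)] show ?thesis .
qed

lemma q_fixed_inverse_R:
  assumes "q_fixed (x + 1)" "x \<notin> \<rat>"
  shows "q_fixed x"
proof -
  define q where "q = qvar"
  obtain A B C D n where M: "mobius_rel fls_X A B C D (q_irrat (x + 1)) (q_irrat (x + 1))"
      "mobius_rel 1 A B C D (x + 1) (x + 1)" "A * D - B * C = qvar ^ n"
      "palindrome (laurent_of_poly ((A + D)\<^sup>2 - 4 * qvar ^ n))" "poly C 1 \<noteq> 0"
    using assms(1) unfolding q_fixed_def by blast
  have "x + 1 \<notin> \<rat>" using irrational_R[of "x + 1"] assms(2) by (metis Rats_1 Rats_diff add_diff_cancel_right')
  then have "q_irrat (x + 1) = fls_X * q_irrat x + 1"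
    using q_irrat_R[of "x + 1"] by (simp add: q_R_def)
  note q = mobius_rel_conj_inverse_R[OF M(1) this]
  have r: "mobius_rel 1 (qvar * (A - C)) (A - C + B - D) (qvar * qvar * C) (qvar * C + qvar * D) x x"
    by (rule mobius_rel_conj_inverse_R[OF M(2)]) simp_all
  have "q * (A - C) + (q * C + q * D) = q * (A + D)"
    "q * (A - C) * (q * C + q * D) - (A - C + B - D) * (q * q * C) = q * (q * (A * D - B * C))"
    by (simp_all add: algebra_simps)
  moreover have "poly (qvar * qvar * C) 1 \<noteq> 0" using M(5) by simp
  ultimately show ?thesis
    unfolding q_def by (intro q_fixed_conjugate[OF q r _ _ _ M(3,4)]) simp
qed

lemma q_fixed_L:
  assumes "q_fixed (slow_step x)" "x \<notin> \<rat>" "0 < x" "x < 1"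
  shows "q_fixed x"
proof -
  define q where "q = qvar"
  obtain A B C D n where M: "mobius_rel fls_X A B C D (q_irrat (slow_step x)) (q_irrat (slow_step x))"
      "mobius_rel 1 A B C D (slow_step x) (slow_step x)" "A * D - B * C = qvar ^ n"
      "palindrome (laurent_of_poly ((A + D)\<^sup>2 - 4 * qvar ^ n))" "poly C 1 \<noteq> 0"
    using assms(1) unfolding q_fixed_def by blast
  note q = mobius_rel_conj_L[OF M(1) q_irrat_slow_step_less[OF assms(2-4)]]
  have "x \<noteq> 1" using assms(4) by simp
  note r = mobius_rel_conj_L[OF M(2) slow_step_inverse(2,3)[OF assms(3) \<open>x \<noteq> 1\<close> assms(4)]]
  have tr: "q * A - q * q * B + (q * q * B + q * D) = q * (A + D)"
    and det: "(q * A - q * q * B) * (q * q * B + q * D) - q * q * B * (q * A + C - q * q * B - q * D) = q * (q * (A * D - B * C))"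
    by (simp_all add: algebra_simps)
  \<comment> \<open>At q = 1 the new lower left entry vanishes iff the old matrix fixes the line of
    (-1, 1), the preimage of infinity under L. The fixed point quadratic would then factor as (y +
    1)(C y - B), making the irrational y a root of a linear equation with C nonzero.\<close>
  have "poly (qvar * A + C - qvar * qvar * B - qvar * D) 1 \<noteq> 0"
  proof
    assume "poly (qvar * A + C - qvar * qvar * B - qvar * D) 1 = 0"
    then have eq: "poly A 1 + poly C 1 = poly B 1 + poly D 1" by simp
    define y where "y = slow_step x"
    have y: "y \<notin> \<rat>" "y > 0" using slow_step_irrational slow_step_pos assms by (auto simp: y_def)
    have "y * (of_int (poly C 1) * y + of_int (poly D 1)) = of_int (poly A 1) * y + of_int (poly B 1)"
      using M(2) by (simp only: mobius_rel_def int_poly_eval_at_1 y_def)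
    moreover have "(of_int (poly A 1) :: real) = of_int (poly B 1) + of_int (poly D 1) - of_int (poly C 1)"
      using arg_cong[OF eq, of "of_int :: int \<Rightarrow> real"] by simp
    ultimately have "(y + 1) * (of_int (poly C 1) * y + of_int (- poly B 1)) = 0"
      by (simp add: algebra_simps)
    then have "of_int (poly C 1) * y + of_int (- poly B 1) = 0" using y(2) by simp
    then show False using linear_rational_root y(1) M(5) by blast
  qed
  from q_fixed_conjugate[OF q r tr[unfolded q_def] det[unfolded q_def] this M(3,4)] show ?thesis .
qed

lemma q_fixed_slow_step:
  assumes "q_fixed (slow_step x)" "x \<notin> \<rat>" "x > 0"
  shows "q_fixed x"
proof (cases "x > 1")
  case True
  then show ?thesis using assms(1,2) by - (rule q_fixed_R, simp_all add: slow_step_def)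
next
  case False
  moreover have "x \<noteq> 1" using assms(2) by auto
  ultimately show ?thesis using assms by - (rule q_fixed_L, simp_all)
qed

lemma q_fixed_funpow:
  assumes "x \<notin> \<rat>" "x > 0"
  shows "q_fixed ((slow_step ^^ n) x) \<Longrightarrow> q_fixed x"
proof (induction n)
  case (Suc n)
  have "q_fixed (slow_step ((slow_step ^^ n) x))" using Suc.prems by simp
  from Suc.IH[OF q_fixed_slow_step[OF this funpow_slow_step[OF assms]]] show ?case .
qed simp

lemma quadratic_root_shift:
  assumes "quadratic_root a b c x"
  shows "quadratic_root a (b - 2 * a * k) (a * k * k - b * k + c) (x + of_int k)"
proof -
  have "of_int a * (x + of_int k)\<^sup>2 + of_int (b - 2 * a * k) * (x + of_int k) + of_int (a * k * k - b * k + c) =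
      of_int a * x\<^sup>2 + of_int b * x + of_int c"
    by (simp add: power2_eq_square algebra_simps)
  then show ?thesis using assms by (simp only: quadratic_root_def)
qed

lemma q_fixed_quadratic:
  assumes "quadratic_root a b c x" "x \<notin> \<rat>" "a \<noteq> 0"
  shows "q_fixed x"
proof -
  \<comment> \<open>General in \<open>b\<close>, \<open>c\<close> and \<open>x\<close> because
    translation changes the form, although its leading coefficient stays \<open>a\<close>.\<close>
  have pos: "q_fixed x" if h: "quadratic_root a b c x" "x \<notin> \<rat>" "x > 0" for b c x
  proof -
    obtain m n where mn: "n > 0" "(slow_step ^^ n) ((slow_step ^^ m) x) = (slow_step ^^ m) x"
      using slow_orbit_periodic[OF h assms(3)] .
    have "q_fixed ((slow_step ^^ m) x)"
      using q_fixed_periodic[OF funpow_slow_step[OF h(2,3)] mn] .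
    then show ?thesis by (rule q_fixed_funpow[OF h(2,3)])
  qed
  obtain k where k: "real k > - x" using reals_Archimedean2 by blast
  have irr: "x + real n \<notin> \<rat>" for n
    using assms(2) by (metis Rats_diff Rats_of_nat add_diff_cancel_right')
  have "x + of_int (int k) \<notin> \<rat>" "x + of_int (int k) > 0" using irr[of k] k by simp_all
  from pos[OF quadratic_root_shift[OF assms(1)] this] have "q_fixed (x + real k)" by simp
  then show ?thesis
  proof (induction k)
    case (Suc k)
    have "q_fixed (x + real k + 1)" using Suc.prems by (simp add: add_ac)
    from Suc.IH[OF q_fixed_inverse_R[OF this irr]] show ?case .
  qed simp
qed

section \<open>From a fixed matrix to the radical, the equation and the invertible matrix\<close>

lemma int_poly_eval_fls_X_nth:
  "(int_poly_eval fls_X P :: rat fls) $$ k = (if k < 0 then 0 else of_int (coeff P (nat k)))"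
proof (induction P arbitrary: k)
  case (pCons a P)
  have "(int_poly_eval fls_X (pCons a P) :: rat fls) $$ k =
      of_int a $$ k + (int_poly_eval fls_X P :: rat fls) $$ (k - 1)"
    by (simp add: fls_X_times_conv_shift)
  also have "\<dots> = (if k < 0 then 0 else of_int (coeff (pCons a P) (nat k)))"
    by (auto simp: pCons.IH fls_of_int_nth coeff_pCons nat_diff_distrib split: nat.splits)
  finally show ?case .
qed simp

lemma int_poly_eval_fls_X_eq_0: "(int_poly_eval fls_X P :: rat fls) = 0 \<Longrightarrow> P = 0"
proof (rule poly_eqI)
  fix i
  assume "(int_poly_eval fls_X P :: rat fls) = 0"
  then show "coeff P i = coeff 0 i"
    using int_poly_eval_fls_X_nth[of P "int i"] by simp
qed

lemma q_fixed_sqrt_form: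
  assumes "q_fixed x" "\<sigma> = 1 \<or> \<sigma> = (-1 :: int)"
  shows "\<exists>R P S Y. S \<noteq> 0 \<and> palindrome (laurent_of_poly P) \<and> Y ^ 2 = fls_of_poly P \<and>
    q_irrat x = (fls_of_poly R + of_int \<sigma> * Y) / fls_of_poly S"
proof -
  obtain A B C D n where M: "mobius_rel fls_X A B C D (q_irrat x) (q_irrat x)"
      "A * D - B * C = qvar ^ n" "palindrome (laurent_of_poly ((A + D)\<^sup>2 - 4 * qvar ^ n))" "poly C 1 \<noteq> 0"
    using assms(1) unfolding q_fixed_def by blast
  define X a b c d where "X = q_irrat x" and "a = (int_poly_eval fls_X A :: rat fls)"
    and "b = (int_poly_eval fls_X B :: rat fls)" and "c = (int_poly_eval fls_X C :: rat fls)"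
    and "d = (int_poly_eval fls_X D :: rat fls)"
  note defs = this
  have "C \<noteq> 0" using M(4) by auto
  then have "c \<noteq> 0" using int_poly_eval_fls_X_eq_0 by (auto simp: c_def)
  have fixed: "X * (c * X + d) = a * X + b" using M(1) by (simp only: mobius_rel_def defs)
  \<comment> \<open>Completing the square in c X^2 + (d - a) X - b = 0 exhibits the root of the
    discriminant as a Laurent series; no square root has to be extracted.\<close>
  define Z where "Z = 2 * c * X + d - a"
  have "Z\<^sup>2 = 4 * c * (X * (c * X + d)) - 4 * c * (a * X) + (d - a)\<^sup>2"
    by (simp add: Z_def power2_eq_square algebra_simps)
  also have "\<dots> = (a + d)\<^sup>2 - 4 * (a * d - b * c)"
    unfolding fixed by (simp add: power2_eq_square algebra_simps)
  also have "\<dots> = fls_of_poly ((A + D)\<^sup>2 - 4 * qvar ^ n)"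
    unfolding M(2)[symmetric] by (simp add: fls_of_poly_eval defs)
  finally have Z: "Z\<^sup>2 = fls_of_poly ((A + D)\<^sup>2 - 4 * qvar ^ n)" .
  have \<sigma>: "(of_int \<sigma> :: rat fls) * (of_int \<sigma> * Z) = Z" "(of_int \<sigma> * Z)\<^sup>2 = Z\<^sup>2"
    using assms(2) by auto
  have "X = (a - d + Z) / (2 * c)"
    using \<open>c \<noteq> 0\<close> by (simp add: Z_def)
  \<comment> \<open>The witness for Y is \<sigma> Z, which realises the prescribed sign because
    \<sigma>^2 = 1.\<close>
  then have "q_irrat x = (fls_of_poly (A - D) + of_int \<sigma> * (of_int \<sigma> * Z)) / fls_of_poly (2 * C)"
    unfolding \<sigma> by (simp add: fls_of_poly_eval defs)
  moreover have "2 * C \<noteq> 0" using \<open>C \<noteq> 0\<close> by simp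
  ultimately show ?thesis using M(3) Z \<sigma>(2) by metis
qed

lemma q_fixed_quadratic_equation:
  assumes "q_fixed x"
  shows "\<exists>A B C. A \<noteq> 0 \<and> fls_of_poly A * q_irrat x ^ 2 + fls_of_poly B * q_irrat x + fls_of_poly C = 0"
proof -
  obtain A B C D where M: "mobius_rel fls_X A B C D (q_irrat x) (q_irrat x)" "poly C 1 \<noteq> 0"
    using assms(1) unfolding q_fixed_def by blast
  have "C \<noteq> 0" using M(2) by auto
  moreover have "fls_of_poly C * q_irrat x ^ 2 + fls_of_poly (D - A) * q_irrat x + fls_of_poly (- B) = 0"
    using M(1) by (simp add: mobius_rel_def fls_of_poly_eval power2_eq_square algebra_simps)
  ultimately show ?thesis by blast
qed

lemma invertible_2x2:
  fixes a b c d u :: "'a::comm_ring_1"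
  assumes "(a * d - b * c) * u = 1"
  shows "invertible (\<chi> i j. if i = 1 then if j = 1 then a else b else if j = 1 then c else d :: 'a ^ 2 ^ 2)"
proof -
  let ?M = "\<chi> i j. if i = 1 then if j = 1 then a else b else if j = 1 then c else d :: 'a ^ 2 ^ 2"
  let ?N = "\<chi> i j. if i = 1 then if j = 1 then d * u else - b * u else if j = 1 then - c * u else a * u :: 'a ^ 2 ^ 2"
  have *: "a * (d * u) - b * (c * u) = 1" using assms by (simp add: algebra_simps)
  have "?M ** ?N = mat 1" "?N ** ?M = mat 1"
    unfolding vec_eq_iff forall_2 using *
    by (simp_all add: matrix_matrix_mult_def sum_2 mat_def algebra_simps)
  then show ?thesis unfolding invertible_def by blast
qed

lemma q_fixed_matrix:
  assumes "q_fixed x"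
  shows "\<exists>M :: int_laurent ^ 2 ^ 2. invertible M \<and> (\<forall>c. M \<noteq> mat c) \<and>
    mobius_den M (q_irrat x) \<noteq> 0 \<and> mobius_num M (q_irrat x) / mobius_den M (q_irrat x) = q_irrat x"
proof -
  obtain A B C D n where M: "mobius_rel fls_X A B C D (q_irrat x) (q_irrat x)"
      "A * D - B * C = qvar ^ n" "poly C 1 \<noteq> 0"
    using assms(1) unfolding q_fixed_def by blast
  define M :: "int_laurent ^ 2 ^ 2" where "M = (\<chi> i j. if i = 1 then if j = 1 then laurent_of_poly A else laurent_of_poly B
    else if j = 1 then laurent_of_poly C else laurent_of_poly D)"
  have nth: "M $ 1 $ 1 = laurent_of_poly A" "M $ 1 $ 2 = laurent_of_poly B"
    "M $ 2 $ 1 = laurent_of_poly C" "M $ 2 $ 2 = laurent_of_poly D"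
    by (simp_all add: M_def)
  have det: "laurent_of_poly A * laurent_of_poly D - laurent_of_poly B * laurent_of_poly C = Poly_Mapping.single (int n) 1"
    using arg_cong[OF M(2), of laurent_of_poly] by (simp add: laurent_of_poly_eval single_power)
  have "invertible M"
    \<comment> \<open>The determinant q^n is a unit among Laurent polynomials, with inverse
      q^(-n).\<close>
    unfolding M_def by (rule invertible_2x2[where u = "Poly_Mapping.single (- int n) 1"]) (simp add: det mult_single)
  moreover have "M \<noteq> mat c" for c
  proof
    assume "M = mat c"
    then have "laurent_of_poly C = 0" using nth(3) by (simp add: mat_def)
    then have "coeff C i = 0" for i
      using lookup_laurent_of_poly[of C "int i"] by simp
    then show False using M(3) by (simp add: poly_altdef)
  qed
  moreover define X a b c d where "X = q_irrat x" and "a = (int_poly_eval fls_X A :: rat fls)"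
    and "b = (int_poly_eval fls_X B :: rat fls)" and "c = (int_poly_eval fls_X C :: rat fls)"
    and "d = (int_poly_eval fls_X D :: rat fls)"
  note defs = this
  have num: "mobius_num M (q_irrat x) = a * X + b" and den: "mobius_den M (q_irrat x) = c * X + d"
    by (simp_all only: mobius_num_def mobius_den_def nth fls_of_poly_def[symmetric] fls_of_poly_eval X_def a_def b_def c_def d_def)
  have fixed: "X * (c * X + d) = a * X + b" using M(1) by (simp only: mobius_rel_def X_def a_def b_def c_def d_def)
  \<comment> \<open>A zero denominator would make the numerator vanish too, placing (X, 1) in the
    kernel of a matrix of determinant q^n.\<close>
  have "c * X + d \<noteq> 0"
  proof
    assume 0: "c * X + d = 0"
    then have "a * X + b = 0" using fixed by simp
    then have "a * (c * X + d) - c * (a * X + b) = 0" using 0 by simp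
    then have "a * d - b * c = 0" by (simp add: algebra_simps)
    moreover have "a * d - b * c = fls_X ^ n"
      using arg_cong[OF M(2), of "int_poly_eval fls_X :: int poly \<Rightarrow> rat fls"] by (simp add: a_def b_def c_def d_def)
    ultimately show False by simp
  qed
  then have "mobius_den M (q_irrat x) \<noteq> 0" "mobius_num M (q_irrat x) / mobius_den M (q_irrat x) = q_irrat x"
    unfolding num den unfolding fixed[symmetric] by (simp_all, simp add: X_def)
  ultimately show ?thesis by blast
qed

section \<open>Periodic continued fractions\<close>

definition cf_step :: "real \<Rightarrow> real" where
  "cf_step x = 1 / (x - of_int \<lfloor>x\<rfloor>)"

definition cf_digit :: "real \<Rightarrow> nat \<Rightarrow> int" where
  "cf_digit x i = \<lfloor>(cf_step ^^ i) x\<rfloor>"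

lemma irrational_frac:
  assumes "x \<notin> \<rat>"
  shows "x - of_int \<lfloor>x\<rfloor> \<notin> \<rat>" "0 < x - of_int \<lfloor>x\<rfloor>" "x - of_int \<lfloor>x\<rfloor> < 1"
proof -
  show irr: "x - of_int \<lfloor>x\<rfloor> \<notin> \<rat>"
    using assms by (metis Rats_add Rats_of_int diff_add_cancel)
  have "x - of_int \<lfloor>x\<rfloor> \<noteq> 0" using irr by (metis Rats_0)
  moreover have "x - of_int \<lfloor>x\<rfloor> \<ge> 0" by simp
  ultimately show "0 < x - of_int \<lfloor>x\<rfloor>" by linarith
  show "x - of_int \<lfloor>x\<rfloor> < 1" by linarith
qed

lemma cf_step_irrational: "x \<notin> \<rat> \<Longrightarrow> cf_step x \<notin> \<rat>"
  using irrational_frac(1)[of x] Rats_divide[OF Rats_1, of "cf_step x"] by (auto simp: cf_step_def)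

lemma cf_step_gt_1: "x \<notin> \<rat> \<Longrightarrow> cf_step x > 1"
  using irrational_frac[of x] by (simp add: cf_step_def)

lemma funpow_cf_step_irrational: "x \<notin> \<rat> \<Longrightarrow> (cf_step ^^ n) x \<notin> \<rat>"
  by (induction n) (auto simp: cf_step_irrational)

lemma cf_step_add_of_int: "cf_step (x + of_int k) = cf_step x"
  by (simp add: cf_step_def)

lemma funpow_slow_step_gt:
  assumes "x \<notin> \<rat>" "real k < x"
  shows "(slow_step ^^ k) x = x - real k"
  using assms(2)
proof (induction k)
  case (Suc k)
  then show ?case by (simp add: slow_step_def)
qed simp

text \<open>In the coordinate 1/x the lower branch is subtraction of 1.\<close>

lemma funpow_slow_step_less:
  assumes "x \<notin> \<rat>" "0 < x" "real k < 1 / x"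
  shows "(slow_step ^^ k) x = 1 / (1 / x - real k)"
  using assms(3)
proof (induction k)
  case 0
  then show ?case by simp
next
  case (Suc k)
  define w where "w = 1 / x - real k"
  have w: "w > 1" using Suc.prems by (simp add: w_def)
  have "(slow_step ^^ Suc k) x = slow_step (1 / w)"
    using Suc by (simp add: w_def)
  also have "\<dots> = 1 / (w - 1)"
    using w by (simp add: slow_step_def field_simps)
  finally show ?case by (simp add: w_def algebra_simps)
qed

lemma floor_less_irrational: "x \<notin> \<rat> \<Longrightarrow> of_int \<lfloor>x\<rfloor> < x"
  using irrational_frac(2)[of x] by linarith

lemma slow_step_frac:
  assumes "x \<notin> \<rat>" "x > 0"
  shows "(slow_step ^^ nat \<lfloor>x\<rfloor>) x = x - of_int \<lfloor>x\<rfloor>"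
proof -
  have "real (nat \<lfloor>x\<rfloor>) = of_int \<lfloor>x\<rfloor>" using assms(2) by simp
  then show ?thesis using funpow_slow_step_gt[OF assms(1), of "nat \<lfloor>x\<rfloor>"] floor_less_irrational[OF assms(1)] by simp
qed

lemma slow_step_cf_step:
  assumes "x \<notin> \<rat>"
  shows "(slow_step ^^ nat \<lfloor>cf_step x\<rfloor>) (x - of_int \<lfloor>x\<rfloor>) = cf_step (cf_step x)"
proof -
  have irr: "cf_step x \<notin> \<rat>" and gt: "cf_step x > 1"
    using assms cf_step_irrational cf_step_gt_1 by auto
  have nat: "real (nat \<lfloor>cf_step x\<rfloor>) = of_int \<lfloor>cf_step x\<rfloor>" using gt by simp
  have inv: "1 / (x - of_int \<lfloor>x\<rfloor>) = cf_step x" by (simp only: cf_step_def)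
  have "real (nat \<lfloor>cf_step x\<rfloor>) < 1 / (x - of_int \<lfloor>x\<rfloor>)"
    unfolding inv nat by (rule floor_less_irrational[OF irr])
  from funpow_slow_step_less[OF irrational_frac(1,2)[OF assms] this] show ?thesis
    unfolding inv nat by (simp only: cf_step_def[of "cf_step x"])
qed

text \<open>A block R^a L^b amounts to two steps of \<open>cf_step\<close>, so it is the complete
  quotients of even index that occur in the slow orbit. The orbit starts at the fractional part to
  cover negative \<open>x\<close>, whence the first index 2.\<close>

lemma funpow_cf_step_in_slow_orbit:
  assumes "x \<notin> \<rat>"
  shows "(cf_step ^^ (2 * Suc k)) x \<in> range (\<lambda>n. (slow_step ^^ n) (x - of_int \<lfloor>x\<rfloor>))"
proof (induction k)
  case 0
  have "(cf_step ^^ (2 * Suc 0)) x = (slow_step ^^ nat \<lfloor>cf_step x\<rfloor>) (x - of_int \<lfloor>x\<rfloor>)"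
    unfolding slow_step_cf_step[OF assms] by (simp add: numeral_2_eq_2)
  then show ?case by blast
next
  case (Suc k)
  define u where "u = (cf_step ^^ (2 * Suc k)) x"
  obtain n where n: "u = (slow_step ^^ n) (x - of_int \<lfloor>x\<rfloor>)"
    using Suc unfolding u_def by blast
  have irr: "u \<notin> \<rat>" and pos: "u > 0"
    unfolding n using funpow_slow_step[OF irrational_frac(1,2)[OF assms]] by auto
  have "(cf_step ^^ (2 * Suc (Suc k))) x = cf_step (cf_step u)"
    by (simp add: u_def)
  also have "\<dots> = (slow_step ^^ nat \<lfloor>cf_step u\<rfloor>) ((slow_step ^^ nat \<lfloor>u\<rfloor>) u)"
    unfolding slow_step_frac[OF irr pos] slow_step_cf_step[OF irr] ..
  also have "\<dots> = (slow_step ^^ (nat \<lfloor>cf_step u\<rfloor> + (nat \<lfloor>u\<rfloor> + n))) (x - of_int \<lfloor>x\<rfloor>)"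
    unfolding n by (simp only: funpow_add o_apply)
  finally show ?case by blast
qed

lemma cf_digit_eventually_periodic:
  assumes "quadratic_root a b c x" "x \<notin> \<rat>" "a \<noteq> 0"
  shows "\<exists>k>0. \<exists>i0. \<forall>i\<ge>i0. cf_digit x (i + k) = cf_digit x i"
proof -
  have "finite (range (\<lambda>n. (slow_step ^^ n) (x + of_int (- \<lfloor>x\<rfloor>))))"
    using finite_slow_orbit[OF quadratic_root_shift[OF assms(1), of "- \<lfloor>x\<rfloor>"]] irrational_frac[OF assms(2)] assms(3)
    by simp
  then have "finite (range (\<lambda>n. (slow_step ^^ n) (x - of_int \<lfloor>x\<rfloor>)))" by simp
  then have fin: "finite (range (\<lambda>k. (cf_step ^^ (2 * Suc k)) x))"
    by (rule finite_subset[rotated]) (use funpow_cf_step_in_slow_orbit[OF assms(2)] in blast)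
  then have "\<not> inj (\<lambda>k. (cf_step ^^ (2 * Suc k)) x)"
    using finite_imageD[of "\<lambda>k. (cf_step ^^ (2 * Suc k)) x" UNIV] by auto
  then obtain i j where ij: "i < j" "(cf_step ^^ (2 * Suc i)) x = (cf_step ^^ (2 * Suc j)) x"
    unfolding inj_def by (metis nat_neq_iff)
  have "cf_digit x (n + 2 * (j - i)) = cf_digit x n" if "n \<ge> 2 * Suc i" for n
  proof -
    have "n + 2 * (j - i) = (n - 2 * Suc i) + 2 * Suc j" "n = (n - 2 * Suc i) + 2 * Suc i"
      using that ij(1) by simp_all
    then show ?thesis
      unfolding cf_digit_def using ij(2) by (metis funpow_add o_apply)
  qed
  then show ?thesis using ij(1) by (intro exI[of _ "2 * (j - i)"]) auto
qed

text \<open>The recursive form of the digit prefix, suited to removing two digits and passing to a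
  complete quotient.\<close>

primrec cf_digits :: "real \<Rightarrow> nat \<Rightarrow> int list" where
  "cf_digits x 0 = []"
| "cf_digits x (Suc n) = \<lfloor>x\<rfloor> # cf_digits (cf_step x) n"

lemma map_cf_digit: "map (cf_digit x) [0..<n] = cf_digits x n"
proof (induction n arbitrary: x)
  case (Suc n)
  have "map (cf_digit x) [0..<Suc n] = cf_digit x 0 # map (cf_digit x) (map Suc [0..<n])"
    by (simp add: upt_conv_Cons map_Suc_upt del: upt_Suc)
  also have "map (cf_digit x) (map Suc [0..<n]) = map (cf_digit (cf_step x)) [0..<n]"
    by (simp add: cf_digit_def funpow_swap1)
  finally show ?case using Suc by (simp add: cf_digit_def)
qed simp

lemma length_cf_digits [simp]: "length (cf_digits x n) = n"
  by (induction n arbitrary: x) auto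

lemma cf_digits_ge_1: "x \<notin> \<rat> \<Longrightarrow> x > 1 \<Longrightarrow> a \<in> set (cf_digits x n) \<Longrightarrow> a \<ge> 1"
proof (induction n arbitrary: x)
  case (Suc n)
  then show ?case
    using Suc.IH[OF cf_step_irrational cf_step_gt_1, of x] by (auto simp: le_floor_iff)
qed simp

lemma hd_cf_digits: "n > 0 \<Longrightarrow> hd (cf_digits x n) = \<lfloor>x\<rfloor>"
  by (cases n) auto

lemma even_digits_cf_digits:
  assumes "x \<notin> \<rat>" "m > 0"
  shows "even_digits (cf_digits x (2 * m))"
proof -
  obtain k where k: "2 * m = Suc k" using assms(2) by (cases "2 * m") auto
  have "even (Suc k)" unfolding k[symmetric] by simp
  then show ?thesis
    unfolding k even_digits_def
    using cf_digits_ge_1[OF cf_step_irrational[OF assms(1)] cf_step_gt_1[OF assms(1)], of _ k] by simp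
qed

lemma q_irrat_funpow_R:
  assumes "x \<notin> \<rat>" "real k < x"
  shows "q_irrat x = (q_R ^^ k) (q_irrat (x - real k))"
  using assms(2)
proof (induction k)
  case (Suc k)
  have "x - real k \<notin> \<rat>" using assms(1) by (metis Rats_add Rats_of_nat diff_add_cancel)
  from q_irrat_R[OF this] have "q_irrat (x - real k) = q_R (q_irrat (x - real (Suc k)))"
    by (simp add: algebra_simps)
  then show ?case using Suc by (simp add: funpow_swap1)
qed simp

lemma q_irrat_funpow_L:
  assumes "x \<notin> \<rat>" "0 < x" "real k < 1 / x"
  shows "q_irrat x = (q_L ^^ k) (q_irrat ((slow_step ^^ k) x))"
  using assms(3)
proof (induction k)
  case (Suc k)
  define y where "y = (slow_step ^^ k) x"
  have "y = 1 / (1 / x - real k)"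
    using funpow_slow_step_less[OF assms(1,2), of k] Suc.prems by (simp add: y_def)
  moreover have "1 / x - real k > 1" using Suc.prems by simp
  ultimately have "y < 1" by simp
  moreover have "y \<notin> \<rat>" "y > 0" using funpow_slow_step[OF assms(1,2)] by (simp_all add: y_def)
  ultimately have "q_irrat y = q_L (q_irrat (slow_step y))"
    using q_irrat_L[of y] by (simp add: slow_step_def)
  then show ?case using Suc by (simp add: y_def funpow_swap1)
qed simp

lemma q_irrat_two_cf_steps:
  assumes "x \<notin> \<rat>" "x > 0"
  shows "q_irrat x = (q_R ^^ nat \<lfloor>x\<rfloor>) ((q_L ^^ nat \<lfloor>cf_step x\<rfloor>) (q_irrat (cf_step (cf_step x))))"
proof -
  let ?y = "x - of_int \<lfloor>x\<rfloor>"
  have "real (nat \<lfloor>x\<rfloor>) = of_int \<lfloor>x\<rfloor>" using assms(2) by simp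
  then have "q_irrat x = (q_R ^^ nat \<lfloor>x\<rfloor>) (q_irrat ?y)"
    using q_irrat_funpow_R[OF assms(1), of "nat \<lfloor>x\<rfloor>"] floor_less_irrational[OF assms(1)] by simp
  moreover have "real (nat \<lfloor>cf_step x\<rfloor>) < 1 / ?y"
    using cf_step_gt_1[OF assms(1)] floor_less_irrational[OF cf_step_irrational[OF assms(1)]]
    by (simp add: cf_step_def[symmetric])
  note q_irrat_funpow_L[OF irrational_frac(1,2)[OF assms(1)] this, unfolded slow_step_cf_step[OF assms(1)]]
  ultimately show ?thesis by simp
qed

lemma funpow_q_R_diff: "f - g \<in> fls_ge k \<Longrightarrow> (q_R ^^ n) f - (q_R ^^ n) g \<in> fls_ge (k + int n)"
proof (induction n)
  case (Suc n)
  from q_R_diff[OF Suc.IH[OF Suc.prems]] show ?case by (simp add: add_ac)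
qed simp

lemma funpow_q_L_diff:
  assumes "f - g \<in> fls_ge k" "f \<in> fls_ge 0" "g \<in> fls_ge 0"
  shows "(q_L ^^ n) f - (q_L ^^ n) g \<in> fls_ge (k + int n)"
proof (induction n)
  case 0
  then show ?case using assms(1) by simp
next
  case (Suc n)
  from q_L_diff[OF Suc.IH funpow_q_L_ge_0[OF assms(2)] funpow_q_L_ge_0[OF assms(3)]]
  show ?case by (simp add: add_ac)
qed

text \<open>Two digits a, b gain a + b orders of q. The first may be 0, but b is at least 1, so
  every pair gains at least one order.\<close>

lemma q_cfrac_cf_digits_approx:
  assumes "x \<notin> \<rat>" "x > 0"
  shows "q_irrat x - q_cfrac fls_X (cf_digits x (2 * Suc m)) \<in> fls_ge (int m)"
  using assms
proof (induction m arbitrary: x)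
  case 0
  have "even_digits (cf_digits x (2 * Suc 0))" using even_digits_cf_digits[OF 0(1), of "Suc 0"] by simp
  moreover have "hd (cf_digits x (2 * Suc 0)) \<ge> 0" using 0(2) by (subst hd_cf_digits) simp_all
  ultimately have "(q_cfrac fls_X (cf_digits x (2 * Suc 0)) :: rat fls) \<in> fls_ge 0"
    using q_cfrac_even_digits by blast
  then show ?case using fls_ge_diff[OF q_irrat_ge_0[OF 0]] by simp
next
  case (Suc m)
  let ?u = "cf_step (cf_step x)" and ?as = "cf_digits (cf_step (cf_step x)) (2 * Suc m)"
  let ?a = "nat \<lfloor>x\<rfloor>" and ?b = "nat \<lfloor>cf_step x\<rfloor>"
  have u: "?u \<notin> \<rat>" "?u > 1" using Suc.prems(1) cf_step_irrational cf_step_gt_1 by blast+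
  have ev: "even_digits ?as" using even_digits_cf_digits[OF u(1), of "Suc m"] by simp
  have hd: "hd ?as \<ge> 1" using u(2) by (simp add: le_floor_iff)
  have b: "?b \<ge> 1" "int ?b = \<lfloor>cf_step x\<rfloor>" "int ?a = \<lfloor>x\<rfloor>"
    using cf_step_gt_1[OF Suc.prems(1)] Suc.prems(2) by (simp_all add: le_nat_iff le_floor_iff)
  have eq: "cf_digits x (2 * Suc (Suc m)) = int ?a # int ?b # ?as"
    unfolding b by simp
  have q: "q_cfrac fls_X (cf_digits x (2 * Suc (Suc m))) = (q_R ^^ ?a) ((q_L ^^ ?b) (q_cfrac fls_X ?as :: rat fls))"
    unfolding eq by (rule q_cfrac_two_steps[OF ev hd])
  have "hd ?as \<ge> 0" using hd by linarith
  from q_cfrac_even_digits[OF ev this] have "(q_cfrac fls_X ?as :: rat fls) \<in> fls_ge 0" ..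
  moreover have "q_irrat ?u \<in> fls_ge 0" using q_irrat_ge_0 u by simp
  moreover have "q_irrat ?u - q_cfrac fls_X ?as \<in> fls_ge (int m)" using Suc.IH[OF u(1)] u(2) by simp
  ultimately have "q_irrat x - q_cfrac fls_X (cf_digits x (2 * Suc (Suc m))) \<in> fls_ge (int m + int ?b + int ?a)"
    unfolding q q_irrat_two_cf_steps[OF Suc.prems] by (intro funpow_q_R_diff funpow_q_L_diff)
  then show ?case by (rule fls_ge_mono) (use b(1) in linarith)
qed

text \<open>Translating \<open>x\<close> by N changes only the first digit and multiplies the error
  by q^N. Undoing the translation loses N orders, uniformly in \<open>m\<close>.\<close>

lemma q_cfrac_cf_digits_approx_shift:
  assumes "x \<notin> \<rat>"
  shows "\<exists>N. \<forall>m. q_irrat x - q_cfrac fls_X (cf_digits x (2 * Suc m)) \<in> fls_ge (int m - N)"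
proof -
  obtain N where N: "real N > - x" using reals_Archimedean2 by blast
  define y where "y = x + real N"
  have irr: "y \<notin> \<rat>"
    unfolding y_def using assms by (metis Rats_diff Rats_of_nat add_diff_cancel_right')
  have pos: "y > 0" using N by (simp add: y_def)
  have "q_R f - q_R g = fls_X * (f - g)" for f g :: "rat fls"
    by (simp add: q_R_def algebra_simps)
  then have X: "(q_R ^^ n) f - (q_R ^^ n) g = fls_X ^ n * (f - g)" for f g :: "rat fls" and n
    by (induction n) (simp_all add: mult.assoc)
  have "q_irrat x - q_cfrac fls_X (cf_digits x (2 * Suc m)) \<in> fls_ge (int m - int N)" for m
  proof -
    let ?f = "q_irrat x - q_cfrac fls_X (cf_digits x (2 * Suc m))"
    have "q_irrat (x + real n) = (q_R ^^ n) (q_irrat x)" for n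
    proof (induction n)
      case (Suc n)
      have "x + real (Suc n) \<notin> \<rat>"
        using assms by (metis Rats_diff Rats_of_nat add_diff_cancel_right')
      from q_irrat_R[OF this] Suc show ?case by (simp add: algebra_simps)
    qed simp
    then have q: "q_irrat y = (q_R ^^ N) (q_irrat x)" by (simp add: y_def)
    have shift: "q_cfrac fls_X ((a + int n) # as) = (q_R ^^ n) (q_cfrac fls_X (a # as) :: rat fls)" for a n as
    proof (induction n)
      case (Suc n)
      then show ?case using q_cfrac_R[of "a + int n" as, where 'a=rat] by (simp add: add_ac)
    qed simp
    have "cf_step y = cf_step x" using cf_step_add_of_int[of x "int N"] by (simp add: y_def)
    then have "cf_digits y (2 * Suc m) = (\<lfloor>x\<rfloor> + int N) # cf_digits (cf_step x) (Suc (2 * m))"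
      by (simp add: y_def)
    also have "q_cfrac fls_X \<dots> = (q_R ^^ N) (q_cfrac fls_X (cf_digits x (2 * Suc m)) :: rat fls)"
      unfolding shift by simp
    finally have "fls_X ^ N * ?f \<in> fls_ge (int m)"
      using q_cfrac_cf_digits_approx[OF irr pos, of m] by (simp only: q X)
    moreover have "(inverse fls_X :: rat fls) ^ n \<in> fls_ge (- int n)" for n
    proof (induction n)
      case (Suc n)
      have "(inverse fls_X :: rat fls) \<in> fls_ge (-1)" by (simp add: fls_ge_iff)
      from fls_ge_mult[OF this Suc] show ?case by (simp del: fls_inverse_X)
    qed simp
    ultimately have "inverse fls_X ^ N * (fls_X ^ N * ?f) \<in> fls_ge (- int N + int m)"
      by (intro fls_ge_mult)
    also have "inverse fls_X ^ N * (fls_X ^ N * ?f) = ?f"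
      by (simp add: power_inverse del: fls_inverse_X)
    finally show ?thesis by simp
  qed
  then show ?thesis by blast
qed

lemma is_q_cfrac_limit_cf_digit:
  assumes "x \<notin> \<rat>"
  shows "is_q_cfrac_limit (\<lambda>i. cf_digit x (i - 1)) (q_irrat x)"
  unfolding is_q_cfrac_limit_def stabilizes_to_def
proof
  fix k
  obtain N where N: "q_irrat x - q_cfrac fls_X (cf_digits x (2 * Suc m)) \<in> fls_ge (int m - N)" for m
    using q_cfrac_cf_digits_approx_shift[OF assms] by blast
  have "q_cfrac fls_X (map (\<lambda>i. cf_digit x (i - 1)) [1..<2 * m + 1]) $$ k = q_irrat x $$ k"
    \<comment> \<open>With m = n + 1 this yields k < n - N, the range in which the error has zero
      coefficients.\<close>
    if m: "m \<ge> Suc (nat (k + N + 1))" for m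
  proof -
    obtain n where n: "m = Suc n" using m by (cases m) auto
    have "[1..<2 * m + 1] = map Suc [0..<2 * m]" by (simp add: map_Suc_upt del: upt_Suc)
    then have "map (\<lambda>i. cf_digit x (i - 1)) [1..<2 * m + 1] = map (cf_digit x) [0..<2 * m]"
      by (simp add: o_def)
    also have "\<dots> = cf_digits x (2 * Suc n)" unfolding map_cf_digit n ..
    finally have eq: "map (\<lambda>i. cf_digit x (i - 1)) [1..<2 * m + 1] = cf_digits x (2 * Suc n)" .
    have "k < int n - N" using m n by linarith
    then have "(q_irrat x - q_cfrac fls_X (cf_digits x (2 * Suc n))) $$ k = 0"
      using N[of n] unfolding fls_ge_def by blast
    then show ?thesis unfolding eq by simp
  qed
  then show "\<forall>\<^sub>F m in sequentially. q_cfrac fls_X (map (\<lambda>i. cf_digit x (i - 1)) [1..<2 * m + 1]) $$ k = q_irrat x $$ k"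
    unfolding eventually_sequentially by blast
qed

lemma q_cfrac_expansion:
  assumes "quadratic_root a b c x" "x \<notin> \<rat>" "a \<noteq> 0"
  shows "\<exists>d. (\<forall>i\<ge>2. d i \<ge> 1) \<and> eventually_periodic d \<and> is_q_cfrac_limit d (q_irrat x)"
proof (intro exI conjI)
  let ?d = "\<lambda>i. cf_digit x (i - 1)"
  show "is_q_cfrac_limit ?d (q_irrat x)" by (rule is_q_cfrac_limit_cf_digit[OF assms(2)])
  show "\<forall>i\<ge>2. ?d i \<ge> 1"
  proof (intro allI impI)
    fix i :: nat
    assume "i \<ge> 2"
    then obtain j where j: "i - 1 = Suc j" by (cases "i - 1") auto
    have "cf_step ((cf_step ^^ j) x) > 1"
      by (rule cf_step_gt_1[OF funpow_cf_step_irrational[OF assms(2)]])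
    then show "?d i \<ge> 1" unfolding j cf_digit_def by (simp add: le_floor_iff)
  qed
  obtain k i0 where k: "k > 0" "\<And>i. i \<ge> i0 \<Longrightarrow> cf_digit x (i + k) = cf_digit x i"
    using cf_digit_eventually_periodic[OF assms] by blast
  have "?d (i + k) = ?d i" if "i \<ge> Suc i0" for i
    using k(2)[of "i - 1"] that by (cases i) auto
  then show "eventually_periodic ?d"
    unfolding eventually_periodic_def using k(1) by blast
qed

lemma sqrt_irrational:
  fixes p :: int
  assumes "p > 0" "\<nexists>k::int. p = k ^ 2"
  shows "sqrt (of_int p) \<notin> \<rat>"
proof
  assume "sqrt (of_int p) \<in> \<rat>"
  then obtain m n :: nat where mn: "n \<noteq> 0" "\<bar>sqrt (of_int p)\<bar> = real m / real n" "coprime m n"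
    by (rule Rats_abs_nat_div_natE)
  have "sqrt (of_int p) * real n = real m" using mn(1,2) assms(1) by simp
  then have "(sqrt (of_int p) * real n)\<^sup>2 = (real m)\<^sup>2" by simp
  then have "of_int (p * (int n)\<^sup>2) = (of_int ((int m)\<^sup>2) :: real)"
    using assms(1) by (simp add: power_mult_distrib)
  then have eq: "p * (int n)\<^sup>2 = (int m)\<^sup>2" by (simp only: of_int_eq_iff)
  then have "(int n)\<^sup>2 dvd (int m)\<^sup>2" by (metis dvd_triv_right)
  moreover have "coprime ((int n)\<^sup>2) ((int m)\<^sup>2)" using mn(3) by (simp add: coprime_commute)
  ultimately have "is_unit ((int n)\<^sup>2)" by (simp add: coprime_absorb_left)
  then have "(int n)\<^sup>2 = 1" by simp
  then show False using eq assms(2) by auto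
qed

theorem theorem1p2:
  fixes r s p \<sigma> :: int and x :: real
  assumes "s > 0" and "p > 0" and "\<nexists>k::int. p = k ^ 2"
    and "\<sigma> = 1 \<or> \<sigma> = -1"
    and "x = (of_int r + of_int \<sigma> * sqrt (of_int p)) / of_int s"
  shows
    "(\<exists>(R::int poly) (P::int poly) (S::int poly) (Y::rat fls).
        S \<noteq> 0 \<and> palindrome (laurent_of_poly P) \<and> Y ^ 2 = fls_of_poly P \<and>
        q_irrat x = (fls_of_poly R + of_int \<sigma> * Y) / fls_of_poly S)
     \<and> (\<exists>(A::int poly) (B::int poly) (C::int poly).
        A \<noteq> 0 \<and>
        fls_of_poly A * q_irrat x ^ 2 + fls_of_poly B * q_irrat x + fls_of_poly C = 0)
     \<and> (\<exists>M :: int_laurent ^ 2 ^ 2.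
        invertible M \<and> (\<forall>c. M \<noteq> mat c) \<and>
        mobius_den M (q_irrat x) \<noteq> 0 \<and>
        mobius_num M (q_irrat x) / mobius_den M (q_irrat x) = q_irrat x)
     \<and> (\<exists>a :: nat \<Rightarrow> int.
        (\<forall>i\<ge>2. a i \<ge> 1) \<and> eventually_periodic a \<and> is_q_cfrac_limit a (q_irrat x))"
proof -
  have sx: "of_int s * x - of_int r = of_int \<sigma> * sqrt (of_int p)"
    using assms(1,5) by simp
  have "(of_int \<sigma> :: real) * of_int \<sigma> = 1" using assms(4) by auto
  then have sqrt: "sqrt (of_int p) = of_int \<sigma> * (of_int s * x - of_int r)"
    unfolding sx by (simp add: mult.assoc[symmetric])
  have irr: "x \<notin> \<rat>"
  proof
    assume "x \<in> \<rat>"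
    then have "sqrt (of_int p) \<in> \<rat>" unfolding sqrt by (intro Rats_mult Rats_diff Rats_of_int)
    then show False using sqrt_irrational[OF assms(2,3)] by blast
  qed
  have "(of_int s * x - of_int r)\<^sup>2 = (of_int p :: real)"
    unfolding sx using assms(2,4) by (auto simp: power_mult_distrib)
  then have root: "quadratic_root (s * s) (- 2 * r * s) (r * r - p) x"
    by (simp add: quadratic_root_def power2_eq_square algebra_simps)
  have "s * s \<noteq> 0" using assms(1) by simp
  note fixed = q_fixed_quadratic[OF root irr this]
  show ?thesis
    by (intro conjI q_fixed_sqrt_form[OF fixed assms(4)] q_fixed_quadratic_equation[OF fixed]
      q_fixed_matrix[OF fixed] q_cfrac_expansion[OF root irr \<open>s * s \<noteq> 0\<close>])
qed

end
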